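(* Let $\mathcal{F}$ be a family of languages which is closed under concatenation, and suppose that the groups $G_1$ and $G_2$ have $\mathcal{F}$-combings $L_1$ and $L_2$, over generating sets $X_1$ and $X_2$. Then the concatenation $L_1L_2$ is an asynchronous $\mathcal{F}$-combing for $G_1\times G_2$ (over the generating set $X_1\cup X_2$), and is an asynchronous bicombing if $L_1$ and $L_2$ are asynchronous bicombings. If $L_1$ and $L_2$ are bijective, then so is $L_1L_2$. If $L_1$ and $L_2$ are both synchronous (respectively both boundedly asynchronous), then so is $L_1L_2$, provided that $L_1$ is a near geodesic language.
   Context: Generating sets are finite and inverse closed. For a group $G$ with identity $e$ and generating set $X$, $X^*$ is the set of all words over $X$; $w=_G v$ means that $w,v$ represent the same element of $G$; $l(w)$ is the length of $w$ as a string, and $l_G(w)$ is the length of the shortest word $v$ over $X$ with $v=_G w$. $\Gamma_{G,X}$ is the Cayley graph (an edge labelled $x$ from $g$ to $gx$), and $d_{G,X}$ is the graph distance on vertices, extended to the path metric on the 1-skeleton. A word $w$ is identified with the path from $e$ labelled by $w$: for $0\le t<l(w)$, $w(t)$ is the point at distance $t$ along the path, and $w(t)=w(l(w))$ for $t\ge l(w)$. Words $v,w$ synchronously $K$-fellow travel if $d_{G,X}(v(t),w(t))\le K$ for all $t$. They asynchronously $K$-fellow travel if there is a strictly increasing differentiable $h:\mathbf{R}\to\mathbf{R}$ mapping $[0,l(v)]$ onto $[0,l(w)]$ with $d_{G,X}(v(t),w(h(t)))\le K$ for all $t>0$; they do so with bound $M$ if moreover $1/M\le h'(t)\le M$ for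 all $t\le l(v)$. A language for $G$ over $X$ is a subset $L\subseteq X^*$ containing at least one representative of each element of $G$; it is bijective if it contains exactly one of each, and near geodesic if for some constant $\varepsilon$, $l(w)-l_G(w)<\varepsilon$ for all $w\in L$. $L$ is a synchronous (resp. asynchronous) combing if there is a constant $K$ such that all pairs $v,w\in L$ with $w=_G vx$ for some $x\in X\cup\{e\}$ synchronously (resp. asynchronously) $K$-fellow travel. It is a synchronous (resp. asynchronous) bicombing if moreover, for all $v,w\in L$ and $x\in X$ with $w=_G xv$, the words $xv$ and $w$ synchronously (resp. asynchronously) $K$-fellow travel. An asynchronous combing or bicombing is boundedly asynchronous if there is a constant $M$ such that all the relevant pairs asynchronously fellow travel with bound $M$. A combing is a language of any of these six types (synchronous, boundedly asynchronous or asynchronous; combing or bicombing). A family of languages $\mathcal{F}$ is any non-empty set of languages over finite alphabets. An $\mathcal{F}$-combing is a combing which is a language in $\mathcal{F}$. Closure under concatenation: $L,L'\in\mathcal{F}$ implies $LL'=\{uv:u\in L,v\in L'\}\in\mathcal{F}$.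
   Formalization: When exactly one of v, w is empty, asynchronous fellow travelling asks h to map [0,∞) onto [0,∞) instead of [0,l(v)] onto [0,l(w)], which is impossible there; read literally, the claim fails, e.g. for Z×Z with the usual normal forms. *)

theory Defs
  imports "HOL-Analysis.Analysis" "HOL-Algebra.Generated_Groups"
begin

section \<open>Words and generating sets\<close>

text \<open>A generating set is a finite set \<open>X\<close> of letters together with a map \<open>f\<close> into the group, so
  that languages for different groups can be languages over one common type of letters. A generating
  set that is literally a subset of the group is the special case where \<open>f\<close> is injective on \<open>X\<close>.\<close>

definition generating_set :: "('a, 'm) monoid_scheme \<Rightarrow> 'c set \<Rightarrow> ('c \<Rightarrow> 'a) \<Rightarrow> bool" where
  "generating_set G X f \<longleftrightarrow> finite X \<and> f ` X \<subseteq> carrier G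
     \<and> (\<forall>x\<in>X. \<exists>y\<in>X. f y = inv\<^bsub>G\<^esub> (f x)) \<and> generate G (f ` X) = carrier G"

definition word_val :: "('a, 'm) monoid_scheme \<Rightarrow> ('c \<Rightarrow> 'a) \<Rightarrow> 'c list \<Rightarrow> 'a" where
  "word_val G f w = foldr (\<lambda>x g. f x \<otimes>\<^bsub>G\<^esub> g) w \<one>\<^bsub>G\<^esub>"

definition geodesic_length ::
    "('a, 'm) monoid_scheme \<Rightarrow> 'c set \<Rightarrow> ('c \<Rightarrow> 'a) \<Rightarrow> 'c list \<Rightarrow> nat" where
  "geodesic_length G X f w =
     (LEAST n. \<exists>v\<in>lists X. word_val G f v = word_val G f w \<and> length v = n)"

section \<open>The Cayley graph and its path metric\<close>

definition cayley_edges :: "('a, 'm) monoid_scheme \<Rightarrow> 'c set \<Rightarrow> ('c \<Rightarrow> 'a) \<Rightarrow> ('a \<times> 'a) set" where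
  "cayley_edges G X f = {(g, g \<otimes>\<^bsub>G\<^esub> f x) | g x. g \<in> carrier G \<and> x \<in> X}"

text \<open>As generating sets are inverse closed, the edge relation is symmetric, and distances may be
  measured along edge paths in the positive direction.\<close>

definition cayley_dist :: "('a, 'm) monoid_scheme \<Rightarrow> 'c set \<Rightarrow> ('c \<Rightarrow> 'a) \<Rightarrow> 'a \<Rightarrow> 'a \<Rightarrow> nat" where
  "cayley_dist G X f g h = (LEAST n. (g, h) \<in> cayley_edges G X f ^^ n)"

text \<open>\<open>OnEdge g x s\<close> with \<open>0 \<le> s \<le> 1\<close> is the point at distance \<open>s\<close> from \<open>g\<close> on the edge labelled
  \<open>x\<close> that starts at \<open>g\<close>. Every pair \<open>(g, x)\<close> contributes an edge of its own; identifying an edge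
  with the inversely labelled edge in the opposite direction would change distances by at most 1.\<close>

datatype ('a, 'c) cayley_point = Vertex 'a | OnEdge 'a 'c real

fun exits :: "('a, 'm) monoid_scheme \<Rightarrow> ('c \<Rightarrow> 'a) \<Rightarrow> ('a, 'c) cayley_point \<Rightarrow> ('a \<times> real) set" where
  "exits G f (Vertex g) = {(g, 0)}"
| "exits G f (OnEdge g x s) = {(g, s), (g \<otimes>\<^bsub>G\<^esub> f x, 1 - s)}"

text \<open>A shortest path between two points either passes through an end vertex of the edge of each of
  them, or stays inside one edge.\<close>

definition path_dist :: "('a, 'm) monoid_scheme \<Rightarrow> 'c set \<Rightarrow> ('c \<Rightarrow> 'a) \<Rightarrow>
    ('a, 'c) cayley_point \<Rightarrow> ('a, 'c) cayley_point \<Rightarrow> real" where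
  "path_dist G X f p q =
     Min ((\<lambda>((g, a), (h, b)). a + real (cayley_dist G X f g h) + b) ` (exits G f p \<times> exits G f q)
        \<union> {\<bar>s - r\<bar> | g x s r. p = OnEdge g x s \<and> q = OnEdge g x r})"

text \<open>Only used for \<open>t \<ge> 0\<close>.\<close>

definition word_path ::
    "('a, 'm) monoid_scheme \<Rightarrow> ('c \<Rightarrow> 'a) \<Rightarrow> 'c list \<Rightarrow> real \<Rightarrow> ('a, 'c) cayley_point" where
  "word_path G f w t =
     (if t < real (length w)
      then OnEdge (word_val G f (take (nat \<lfloor>t\<rfloor>) w)) (w ! nat \<lfloor>t\<rfloor>) (frac t)
      else Vertex (word_val G f w))"

section \<open>Fellow travelling\<close>

definition sync_fellow_travel ::
    "('a, 'm) monoid_scheme \<Rightarrow> 'c set \<Rightarrow> ('c \<Rightarrow> 'a) \<Rightarrow> real \<Rightarrow> 'c list \<Rightarrow> 'c list \<Rightarrow> bool" where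
  "sync_fellow_travel G X f K v w \<longleftrightarrow>
     (\<forall>t\<ge>0. path_dist G X f (word_path G f v t) (word_path G f w t) \<le> K)"

text \<open>If exactly one of the two words is empty, no strictly increasing function maps
  \<open>[0, l(v)]\<close> onto \<open>[0, l(w)]\<close>. Since the paths are constant from the end of the words on, the two
  paths are in this case compared as paths on \<open>[0, \<infinity>)\<close>: the non-empty word has to stay within
  distance \<open>K\<close> of the identity. Without this clause, no combing of a non-trivial group that contains
  the empty word, synchronous or not, would be an asynchronous combing.\<close>

definition reparametrization :: "'c list \<Rightarrow> 'c list \<Rightarrow> (real \<Rightarrow> real) \<Rightarrow> bool" where
  "reparametrization v w h \<longleftrightarrow> strict_mono h \<and> h differentiable_on UNIV
     \<and> (if v = [] \<longleftrightarrow> w = []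
        then h ` {0..real (length v)} = {0..real (length w)}
        else h ` {0..} = {0..})"

definition async_fellow_travel ::
    "('a, 'm) monoid_scheme \<Rightarrow> 'c set \<Rightarrow> ('c \<Rightarrow> 'a) \<Rightarrow> real \<Rightarrow> 'c list \<Rightarrow> 'c list \<Rightarrow> bool" where
  "async_fellow_travel G X f K v w \<longleftrightarrow>
     (\<exists>h. reparametrization v w h
        \<and> (\<forall>t>0. path_dist G X f (word_path G f v t) (word_path G f w (h t)) \<le> K))"

definition bounded_async_fellow_travel ::
    "('a, 'm) monoid_scheme \<Rightarrow> 'c set \<Rightarrow> ('c \<Rightarrow> 'a) \<Rightarrow> real \<Rightarrow> real \<Rightarrow> 'c list \<Rightarrow> 'c list \<Rightarrow> bool" where
  "bounded_async_fellow_travel G X f K M v w \<longleftrightarrow>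
     (\<exists>h. reparametrization v w h
        \<and> (\<forall>t>0. path_dist G X f (word_path G f v t) (word_path G f w (h t)) \<le> K)
        \<and> (\<forall>t\<le>real (length v). 1 / M \<le> deriv h t \<and> deriv h t \<le> M))"

section \<open>Languages for groups and combings\<close>

definition language_for ::
    "('a, 'm) monoid_scheme \<Rightarrow> 'c set \<Rightarrow> ('c \<Rightarrow> 'a) \<Rightarrow> 'c list set \<Rightarrow> bool" where
  "language_for G X f L \<longleftrightarrow> L \<subseteq> lists X \<and> (\<forall>g\<in>carrier G. \<exists>w\<in>L. word_val G f w = g)"

definition bijective_language ::
    "('a, 'm) monoid_scheme \<Rightarrow> 'c set \<Rightarrow> ('c \<Rightarrow> 'a) \<Rightarrow> 'c list set \<Rightarrow> bool" where
  "bijective_language G X f L \<longleftrightarrow>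
     language_for G X f L \<and> (\<forall>g\<in>carrier G. \<exists>!w. w \<in> L \<and> word_val G f w = g)"

definition near_geodesic ::
    "('a, 'm) monoid_scheme \<Rightarrow> 'c set \<Rightarrow> ('c \<Rightarrow> 'a) \<Rightarrow> 'c list set \<Rightarrow> bool" where
  "near_geodesic G X f L \<longleftrightarrow> language_for G X f L
     \<and> (\<exists>\<epsilon>::real. \<forall>w\<in>L. real (length w) - real (geodesic_length G X f w) < \<epsilon>)"

definition combing_pairs ::
    "('a, 'm) monoid_scheme \<Rightarrow> 'c set \<Rightarrow> ('c \<Rightarrow> 'a) \<Rightarrow> 'c list set \<Rightarrow> ('c list \<times> 'c list) set" where
  "combing_pairs G X f L =
     {(v, w). v \<in> L \<and> w \<in> L
        \<and> (word_val G f w = word_val G f v \<or> (\<exists>x\<in>X. word_val G f w = word_val G f (v @ [x])))}"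

definition bicombing_pairs ::
    "('a, 'm) monoid_scheme \<Rightarrow> 'c set \<Rightarrow> ('c \<Rightarrow> 'a) \<Rightarrow> 'c list set \<Rightarrow> ('c list \<times> 'c list) set" where
  "bicombing_pairs G X f L = combing_pairs G X f L
     \<union> {(x # v, w) | x v w. x \<in> X \<and> v \<in> L \<and> w \<in> L \<and> word_val G f w = word_val G f (x # v)}"

definition sync_combing ::
    "('a, 'm) monoid_scheme \<Rightarrow> 'c set \<Rightarrow> ('c \<Rightarrow> 'a) \<Rightarrow> 'c list set \<Rightarrow> bool" where
  "sync_combing G X f L \<longleftrightarrow> language_for G X f L
     \<and> (\<exists>K. \<forall>(v, w)\<in>combing_pairs G X f L. sync_fellow_travel G X f K v w)"

definition sync_bicombing ::
    "('a, 'm) monoid_scheme \<Rightarrow> 'c set \<Rightarrow> ('c \<Rightarrow> 'a) \<Rightarrow> 'c list set \<Rightarrow> bool" where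
  "sync_bicombing G X f L \<longleftrightarrow> language_for G X f L
     \<and> (\<exists>K. \<forall>(v, w)\<in>bicombing_pairs G X f L. sync_fellow_travel G X f K v w)"

definition async_combing ::
    "('a, 'm) monoid_scheme \<Rightarrow> 'c set \<Rightarrow> ('c \<Rightarrow> 'a) \<Rightarrow> 'c list set \<Rightarrow> bool" where
  "async_combing G X f L \<longleftrightarrow> language_for G X f L
     \<and> (\<exists>K. \<forall>(v, w)\<in>combing_pairs G X f L. async_fellow_travel G X f K v w)"

definition async_bicombing ::
    "('a, 'm) monoid_scheme \<Rightarrow> 'c set \<Rightarrow> ('c \<Rightarrow> 'a) \<Rightarrow> 'c list set \<Rightarrow> bool" where
  "async_bicombing G X f L \<longleftrightarrow> language_for G X f L
     \<and> (\<exists>K. \<forall>(v, w)\<in>bicombing_pairs G X f L. async_fellow_travel G X f K v w)"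

definition bounded_async_combing ::
    "('a, 'm) monoid_scheme \<Rightarrow> 'c set \<Rightarrow> ('c \<Rightarrow> 'a) \<Rightarrow> 'c list set \<Rightarrow> bool" where
  "bounded_async_combing G X f L \<longleftrightarrow> language_for G X f L
     \<and> (\<exists>K M. \<forall>(v, w)\<in>combing_pairs G X f L. bounded_async_fellow_travel G X f K M v w)"

definition bounded_async_bicombing ::
    "('a, 'm) monoid_scheme \<Rightarrow> 'c set \<Rightarrow> ('c \<Rightarrow> 'a) \<Rightarrow> 'c list set \<Rightarrow> bool" where
  "bounded_async_bicombing G X f L \<longleftrightarrow> language_for G X f L
     \<and> (\<exists>K M. \<forall>(v, w)\<in>bicombing_pairs G X f L. bounded_async_fellow_travel G X f K M v w)"

definition combing ::
    "('a, 'm) monoid_scheme \<Rightarrow> 'c set \<Rightarrow> ('c \<Rightarrow> 'a) \<Rightarrow> 'c list set \<Rightarrow> bool" where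
  "combing G X f L \<longleftrightarrow>
     sync_combing G X f L \<or> bounded_async_combing G X f L \<or> async_combing G X f L
     \<or> sync_bicombing G X f L \<or> bounded_async_bicombing G X f L \<or> async_bicombing G X f L"

section \<open>Families of languages, concatenation, and direct products\<close>

definition language_family :: "'c list set set \<Rightarrow> bool" where
  "language_family F \<longleftrightarrow> F \<noteq> {} \<and> (\<forall>L\<in>F. \<exists>A. finite A \<and> L \<subseteq> lists A)"

definition lang_concat :: "'c list set \<Rightarrow> 'c list set \<Rightarrow> 'c list set" where
  "lang_concat L L' = {u @ v | u v. u \<in> L \<and> v \<in> L'}"

text \<open>The map on \<open>X1 \<union> X2\<close> induced by the embeddings of the two factors into the direct product.
  It is meaningful for letters in \<open>X1 \<inter> X2\<close> only if they stand for the identity in both groups.\<close>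

definition product_gens :: "('a, 'm) monoid_scheme \<Rightarrow> ('b, 'n) monoid_scheme \<Rightarrow> 'c set \<Rightarrow>
    ('c \<Rightarrow> 'a) \<Rightarrow> ('c \<Rightarrow> 'b) \<Rightarrow> 'c \<Rightarrow> 'a \<times> 'b" where
  "product_gens G1 G2 X1 f1 f2 x =
     (if x \<in> X1 then (f1 x, \<one>\<^bsub>G2\<^esub>) else (\<one>\<^bsub>G1\<^esub>, f2 x))"

end

theory Submission
  imports Defs
begin

text \<open>Write a word of \<open>L1 L2\<close> as \<open>u @ v\<close>. Its path first runs through \<open>u\<close> in the factor \<open>G1\<close> and then
  through \<open>v\<close> in the factor \<open>G2\<close>, so at time \<open>t\<close> its coordinates are \<open>u(t)\<close> and \<open>v(t - l(u))\<close>. If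
  \<open>u' @ v'\<close> ends within one letter of \<open>u @ v\<close>, then that letter lies in one of the two generating sets,
  so \<open>u\<close>, \<open>u'\<close> and \<open>v\<close>, \<open>v'\<close> are pairs of the given combings. Follow \<open>u\<close>, \<open>u'\<close> until both are finished
  and then \<open>v\<close>, \<open>v'\<close>: the concatenated reparametrization keeps both coordinates close, with slopes in
  the same bounds (\<open>fellow_concat\<close>). Without a reparametrization the second parts start at the times
  \<open>l(u)\<close> and \<open>l(u')\<close>. If \<open>L1\<close> is near geodesic these differ by a constant, and delaying a path
  by a constant moves it by at most a constant (\<open>sync_pairs_concat\<close>). For multiplication by a letter \<open>x\<close>
  of \<open>G2\<close> on the left, \<open>x\<close> commutes with \<open>u\<close>, so the path of \<open>x u v\<close> stays close to that of \<open>u x v\<close>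
  (\<open>pos_move_letter\<close>), and \<open>x v\<close>, \<open>v'\<close> is a pair of the given bicombing.

  Three points need work. First, concatenating two differentiable functions creates a corner. All
  distances matter only up to a constant, so paths can be described by the vertices that they pass and
  reparametrizations by continuous functions with all chord slopes in a convex set of positive reals: all
  of them in the unbounded case, \<open>[1/M, M]\<close> in the bounded case. Such functions can be glued, and
  averaging over a unit window makes them differentiable again (\<open>track_smooth\<close>).

  Second, if just one of \<open>u\<close> and \<open>u'\<close>, or of \<open>v\<close> and \<open>v'\<close>, is empty, there is no reparametrization between
  them, only the information that the other one stays near the identity. It is then traversed while the
  path of the other concatenation moves along half an edge, unless both concatenations stay near the
  identity altogether. The slopes that this needs depend on the length of the
  traversed word. In a boundedly asynchronous combing there is a bound for it: all non-empty
  representatives of one element have comparable lengths, and only finitely many elements are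
  within one letter of the identity (\<open>bounded_length_against_empty\<close>).

  Third, a synchronous combing is asynchronous although the identity does not map \<open>[0, l(v)]\<close>
  onto \<open>[0, l(w)]\<close>: as the shorter path has stopped, it can be slowed down just before its end
  (\<open>near_imp_fellow\<close>).\<close>

section \<open>Reparametrizations with prescribed chord slopes\<close>

definition slopes_in :: "real set \<Rightarrow> real set \<Rightarrow> (real \<Rightarrow> real) \<Rightarrow> bool" where
  "slopes_in S A H \<longleftrightarrow> (\<forall>s\<in>A. \<forall>t\<in>A. s < t \<longrightarrow> (H t - H s) / (t - s) \<in> S)"

lemma slopes_inD: "slopes_in S A H \<Longrightarrow> s \<in> A \<Longrightarrow> t \<in> A \<Longrightarrow> s < t \<Longrightarrow> (H t - H s) / (t - s) \<in> S"
  unfolding slopes_in_def by blast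

lemma slopes_in_subset: "slopes_in S A H \<Longrightarrow> B \<subseteq> A \<Longrightarrow> slopes_in S B H"
  unfolding slopes_in_def by blast

lemma slopes_in_linear: "p \<in> S \<Longrightarrow> slopes_in S A (\<lambda>t. c + p * (t - a))"
  unfolding slopes_in_def by (auto simp flip: right_diff_distrib)

lemma slopes_in_strict_mono:
  assumes "slopes_in S A H" "S \<subseteq> {0<..}" "s \<in> A" "t \<in> A" "s < t"
  shows "H s < H t"
  using slopes_inD[OF assms(1,3-5)] assms(2,5) by (force simp: zero_less_divide_iff)

text \<open>A chord across the meeting point \<open>c\<close> is a weighted mean of the chords on its two sides, so
  convexity of the set of slopes is all that gluing needs.\<close>

lemma paste:
  assumes S: "convex S" and "closed A" "closed B" and c: "c \<in> A" "c \<in> B"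
    and A: "\<And>s. s \<in> A \<Longrightarrow> s \<le> c" and B: "\<And>t. t \<in> B \<Longrightarrow> c \<le> t"
    and cont: "continuous_on A H1" "continuous_on B H2" and eq: "H1 c = H2 c"
    and sl: "slopes_in S A H1" "slopes_in S B H2"
  defines "H \<equiv> \<lambda>t. if t \<le> c then H1 t else H2 t"
  shows "continuous_on (A \<union> B) H" and "slopes_in S (A \<union> B) H"
proof -
  have HA: "H t = H1 t" if "t \<in> A" for t using A[OF that] by (simp add: H_def)
  have HB: "H t = H2 t" if "t \<in> B" for t
    using B[OF that] eq by (cases "t = c") (auto simp: H_def)
  show "continuous_on (A \<union> B) H"
  proof (rule continuous_on_closed_Un)
    show "continuous_on A H" using cont(1) by (simp cong: continuous_on_cong add: HA)
    show "continuous_on B H" using cont(2) by (simp cong: continuous_on_cong add: HB)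
  qed fact+
  have mix: "(H t - H s) / (t - s) \<in> S" if st: "s \<in> A" "t \<in> B" "s < c" "c < t" for s t
  proof -
    have 1: "(H c - H s) / (c - s) \<in> S" "(H t - H c) / (t - c) \<in> S"
      using slopes_inD[OF sl(1), of s c] slopes_inD[OF sl(2), of c t] st c eq
      by (simp_all add: HA HB)
    have "(H t - H s) / (t - s)
        = ((c - s) / (t - s)) *\<^sub>R ((H c - H s) / (c - s)) + ((t - c) / (t - s)) *\<^sub>R ((H t - H c) / (t - c))"
      using st by (simp add: add_divide_distrib[symmetric])
    also have "\<dots> \<in> S"
      by (rule convexD[OF S 1]) (use st in \<open>simp_all add: add_divide_distrib[symmetric]\<close>)
    finally show ?thesis .
  qed
  show "slopes_in S (A \<union> B) H"
    unfolding slopes_in_def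
  proof (intro ballI impI)
    fix s t assume st: "s \<in> A \<union> B" "t \<in> A \<union> B" "s < t"
    consider "s \<in> A" "t \<in> A" | "s \<in> B" "t \<in> B" | "s \<in> A" "t \<in> B" "s < c" "c < t"
      using st c A[of s] A[of t] B[of s] B[of t] by (smt (verit) Un_iff)
    then show "(H t - H s) / (t - s) \<in> S"
    proof cases
      case 1 then show ?thesis using slopes_inD[OF sl(1), of s t] st by (simp add: HA)
    next
      case 2 then show ?thesis using slopes_inD[OF sl(2), of s t] st by (simp add: HB)
    qed (rule mix)
  qed
qed

text \<open>A reparametrization from \<open>[a, b]\<close> onto \<open>[c, d]\<close> that matches only pairs of times satisfying \<open>P\<close>.
  It is continuous rather than differentiable so that pieces can be joined, and its start \<open>(a, c)\<close> and
  end \<open>(b, d)\<close> are parameters so that joining composes like arrows.\<close>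

definition track ::
    "real set \<Rightarrow> (real \<Rightarrow> real \<Rightarrow> bool) \<Rightarrow> real \<Rightarrow> real \<Rightarrow> real \<Rightarrow> real \<Rightarrow> bool" where
  "track S P a c b d \<longleftrightarrow> (\<exists>H. continuous_on {a..b} H \<and> slopes_in S {a..b} H
     \<and> a \<le> b \<and> H a = c \<and> H b = d \<and> (\<forall>t\<in>{a..b}. P t (H t)))"

lemma track_refl: "P a c \<Longrightarrow> track S P a c a c"
  unfolding track_def by (intro exI[of _ "\<lambda>_. c"]) (auto simp: slopes_in_def)

lemma track_mono:
  assumes "track S P a c b d" "S \<subseteq> S'" "S \<subseteq> {0<..}"
    and "\<And>t s. a \<le> t \<Longrightarrow> t \<le> b \<Longrightarrow> c \<le> s \<Longrightarrow> s \<le> d \<Longrightarrow> P t s \<Longrightarrow> P' t s"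
  shows "track S' P' a c b d"
proof -
  obtain H where H: "continuous_on {a..b} H" "slopes_in S {a..b} H"
     "a \<le> b" "H a = c" "H b = d" "\<And>t. t \<in> {a..b} \<Longrightarrow> P t (H t)"
    using assms(1) unfolding track_def by auto
  have "c \<le> H t \<and> H t \<le> d" if "t \<in> {a..b}" for t
    using slopes_in_strict_mono[OF H(2) assms(3), of a t]
      slopes_in_strict_mono[OF H(2) assms(3), of t b] H(3-5) that
    by (cases "t = a"; cases "t = b") (auto simp: less_imp_le)
  moreover have "slopes_in S' {a..b} H" using H(2) assms(2) unfolding slopes_in_def by blast
  ultimately show ?thesis
    unfolding track_def using H assms(4) by (intro exI[of _ H]) auto
qed

lemma track_ends:
  assumes "track S P a c b d" shows "P a c" "P b d" "a \<le> b"
  using assms unfolding track_def by force+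

lemma track_slope: "track S P a c b d \<Longrightarrow> a < b \<Longrightarrow> (d - c) / (b - a) \<in> S"
  unfolding track_def slopes_in_def by force

text \<open>On a rectangle in which every pair of times is admissible the shape of the reparametrization is
  irrelevant, and only its mean slope has to be checked.\<close>

lemma track_linear:
  assumes "a < b" "(d - c) / (b - a) \<in> S" "S \<subseteq> {0<..}"
    and P: "\<And>t s. a \<le> t \<Longrightarrow> t \<le> b \<Longrightarrow> c \<le> s \<Longrightarrow> s \<le> d \<Longrightarrow> P t s"
  shows "track S P a c b d"
proof -
  define p where "p = (d - c) / (b - a)"
  have p: "p \<in> S" "p * (b - a) = d - c" using assms(1,2) by (auto simp: p_def)
  have "track S (\<lambda>t s. True) a c b d"
    unfolding track_def
    by (rule exI[of _ "\<lambda>t. c + p * (t - a)"], intro conjI)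
       (use assms(1) p in \<open>auto intro!: continuous_intros slopes_in_linear\<close>)
  then show ?thesis by (rule track_mono) (use assms in auto)
qed

lemma track_join:
  assumes "convex S" and 1: "track S P a c b d" and 2: "track S P b d e k"
  shows "track S P a c e k"
proof -
  obtain H1 where H1: "continuous_on {a..b} H1" "slopes_in S {a..b} H1"
     "a \<le> b" "H1 a = c" "H1 b = d" "\<And>t. t \<in> {a..b} \<Longrightarrow> P t (H1 t)"
    using 1 unfolding track_def by auto
  obtain H2 where H2: "continuous_on {b..e} H2" "slopes_in S {b..e} H2"
     "b \<le> e" "H2 b = d" "H2 e = k" "\<And>t. t \<in> {b..e} \<Longrightarrow> P t (H2 t)"
    using 2 unfolding track_def by auto
  let ?H = "\<lambda>t. if t \<le> b then H1 t else H2 t"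
  have "continuous_on ({a..b} \<union> {b..e}) ?H" "slopes_in S ({a..b} \<union> {b..e}) ?H"
    by (rule paste[OF assms(1)]; use H1 H2 in auto)+
  moreover have "{a..b} \<union> {b..e} = {a..e}" using H1(3) H2(3) by auto
  ultimately show ?thesis
    unfolding track_def using H1 H2 by (intro exI[of _ ?H]) auto
qed

lemma track_split:
  assumes "track S P a c b d" "a \<le> t" "t \<le> b"
  obtains s where "track S P a c t s" "track S P t s b d"
proof -
  obtain H where H: "continuous_on {a..b} H" "slopes_in S {a..b} H"
     "a \<le> b" "H a = c" "H b = d" "\<And>t. t \<in> {a..b} \<Longrightarrow> P t (H t)"
    using assms(1) unfolding track_def by auto
  have "track S P a c t (H t)"
    unfolding track_def using H assms(2,3)
    by (intro exI[of _ H] conjI) (auto intro: continuous_on_subset slopes_in_subset)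
  moreover have "track S P t (H t) b d"
    unfolding track_def using H assms(2,3)
    by (intro exI[of _ H] conjI) (auto intro: continuous_on_subset slopes_in_subset)
  ultimately show ?thesis by (rule that)
qed

lemma track_onto:
  assumes "track S P a c b d" "c \<le> s" "s \<le> d"
  obtains t where "a \<le> t" "t \<le> b" "P t s"
proof -
  obtain H where H: "continuous_on {a..b} H" "a \<le> b" "H a = c" "H b = d"
      "\<And>t. t \<in> {a..b} \<Longrightarrow> P t (H t)"
    using assms(1) unfolding track_def by auto
  obtain t where "a \<le> t" "t \<le> b" "H t = s"
    using IVT'[of H a s b] H assms by auto
  then show ?thesis using H(5)[of t] by (intro that) auto
qed

lemma track_shift:
  assumes "track S (\<lambda>t s. P (t + u) (s + v)) a c b d"
  shows "track S P (a + u) (c + v) (b + u) (d + v)"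
proof -
  obtain H where H: "continuous_on {a..b} H" "slopes_in S {a..b} H"
     "a \<le> b" "H a = c" "H b = d" "\<And>t. t \<in> {a..b} \<Longrightarrow> P (t + u) (H t + v)"
    using assms unfolding track_def by auto
  have "continuous_on {a+u..b+u} (\<lambda>t. H (t - u) + v)"
    by (intro continuous_intros continuous_on_compose2[OF H(1)]) auto
  moreover have "slopes_in S {a+u..b+u} (\<lambda>t. H (t - u) + v)"
    unfolding slopes_in_def
  proof (intro ballI impI)
    fix s t assume "s \<in> {a+u..b+u}" "t \<in> {a+u..b+u}" "s < t"
    then show "(H (t - u) + v - (H (s - u) + v)) / (t - s) \<in> S"
      using slopes_inD[OF H(2), of "s - u" "t - u"] by auto
  qed
  moreover have "P t (H (t - u) + v)" if "t \<in> {a+u..b+u}" for t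
    using H(6)[of "t - u"] that by auto
  ultimately show ?thesis
    unfolding track_def using H by (intro exI[of _ "\<lambda>t. H (t - u) + v"]) auto
qed

text \<open>Closure under inverses makes fellow travelling symmetric, and the slope 1 admits the identity.
  The positive reals and the intervals \<open>[1/M, M]\<close> are the two classes of interest.\<close>

definition slope_class :: "real set \<Rightarrow> bool" where
  "slope_class S \<longleftrightarrow> convex S \<and> S \<subseteq> {0<..} \<and> 1 \<in> S \<and> (\<forall>p\<in>S. inverse p \<in> S)"

lemma slope_classD: "slope_class S \<Longrightarrow> convex S" "slope_class S \<Longrightarrow> S \<subseteq> {0<..}"
  by (simp_all add: slope_class_def)

lemma slope_class_pos: "slope_class {0<..}"
  by (auto simp: slope_class_def)

lemma slope_class_bounded: "M \<ge> 1 \<Longrightarrow> slope_class {1/M..M}"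
proof -
  assume M: "M \<ge> 1"
  have "0 < p" if "1/M \<le> p" for p using that M by (smt (verit) zero_less_divide_1_iff)
  then show ?thesis using M
    by (auto simp: slope_class_def field_simps)
qed

lemma track_sym:
  assumes "slope_class S" and tr: "track S P a c b d"
  shows "track S (\<lambda>s t. P t s) c a d b"
proof -
  obtain H where H: "continuous_on {a..b} H" "slopes_in S {a..b} H"
     "a \<le> b" "H a = c" "H b = d" "\<And>t. t \<in> {a..b} \<Longrightarrow> P t (H t)"
    using tr unfolding track_def by auto
  have S: "S \<subseteq> {0<..}" "\<And>p. p \<in> S \<Longrightarrow> inverse p \<in> S" using assms(1) by (auto simp: slope_class_def)
  have mono: "H s < H t" if "s \<in> {a..b}" "t \<in> {a..b}" "s < t" for s t
    using slopes_in_strict_mono[OF H(2) S(1)] that .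
  have inj: "inj_on H {a..b}"
    by (rule linorder_inj_onI) (use mono in \<open>force+\<close>)
  have img: "H ` {a..b} = {c..d}"
  proof
    show "H ` {a..b} \<subseteq> {c..d}"
    proof safe
      fix t assume "t \<in> {a..b}"
      then show "H t \<in> {c..d}" using mono[of a t] mono[of t b] H(3-5)
        by (cases "t = a"; cases "t = b") (auto simp: less_imp_le)
    qed
    show "{c..d} \<subseteq> H ` {a..b}"
    proof
      fix s assume "s \<in> {c..d}"
      then obtain t where "a \<le> t" "t \<le> b" "H t = s"
        using IVT'[of H a s b] H by auto
      then show "s \<in> H ` {a..b}" by auto
    qed
  qed
  define J where "J = inv_into {a..b} H"
  have JH: "J (H t) = t" if "t \<in> {a..b}" for t using inj that by (simp add: J_def)
  have "continuous_on {c..d} J"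
    using continuous_on_inv[OF H(1), of J] JH img by auto
  moreover have "slopes_in S {c..d} J"
    unfolding slopes_in_def
  proof (intro ballI impI)
    fix s t assume st: "s \<in> {c..d}" "t \<in> {c..d}" "s < t"
    obtain s' t' where s': "s' \<in> {a..b}" "s = H s'" and t': "t' \<in> {a..b}" "t = H t'"
      using st img by blast
    have "s' < t'" using mono[of t' s'] st s' t' by (cases s' t' rule: linorder_cases) auto
    then have "inverse ((H t' - H s') / (t' - s')) \<in> S"
      using slopes_inD[OF H(2)] s' t' S(2) by blast
    then show "(J t - J s) / (t - s) \<in> S" using s' t' by (simp add: JH)
  qed
  moreover have "\<forall>s\<in>{c..d}. P (J s) s"
  proof
    fix s assume "s \<in> {c..d}"
    then obtain t where "t \<in> {a..b}" "s = H t" using img by blast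
    then show "P (J s) s" using H(6) JH by simp
  qed
  moreover have "J c = a" "J d = b" using JH[of a] JH[of b] H by auto
  moreover have "c \<le> d" using img H(3) by (metis atLeastatMost_empty_iff2 image_is_empty)
  ultimately show ?thesis unfolding track_def by blast
qed

section \<open>Smoothing a reparametrization\<close>

text \<open>With an antiderivative \<open>F\<close> of \<open>H\<close>, the mean \<open>F (t + 1/2) - F (t - 1/2)\<close> of \<open>H\<close> over a unit window
  has a chord slope of \<open>H\<close> as its derivative, takes a value of \<open>H\<close> at a time less than half a unit
  away, and does not change the value at a point around which \<open>H\<close> is odd.\<close>

lemma box_average:
  fixes H :: "real \<Rightarrow> real"
  assumes "continuous_on UNIV H"
  obtains h where "\<And>t. (h has_real_derivative H (t + 1/2) - H (t - 1/2)) (at t)"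
    and "\<And>t. \<exists>s. \<bar>s - t\<bar> < 1/2 \<and> h t = H s"
    and "\<And>c. (\<And>x. 0 \<le> x \<Longrightarrow> x \<le> 1/2 \<Longrightarrow> H (c + x) + H (c - x) = 2 * H c) \<Longrightarrow> h c = H c"
proof -
  have "\<exists>F. \<forall>x::real. (-\<infinity>::ereal) < ereal x \<longrightarrow> ereal x < \<infinity> \<longrightarrow> (F has_vector_derivative H x) (at x)"
    by (rule einterval_antiderivative)
       (use assms in \<open>auto simp: continuous_on_eq_continuous_at\<close>)
  then obtain F where F: "\<And>x. (F has_real_derivative H x) (at x)"
    by (auto simp: has_real_derivative_iff_has_vector_derivative)
  define h where "h t = F (t + 1/2) - F (t - 1/2)" for t
  show ?thesis
  proof (rule that)
    fix t show "(h has_real_derivative H (t + 1/2) - H (t - 1/2)) (at t)"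
      unfolding h_def by (auto intro!: derivative_eq_intros DERIV_chain2[OF F])
  next
    fix t :: real
    obtain s where "t - 1/2 < s" "s < t + 1/2" "F (t + 1/2) - F (t - 1/2) = (t + 1/2 - (t - 1/2)) * H s"
      using MVT2[of "t - 1/2" "t + 1/2" F H] F by auto
    then show "\<exists>s. \<bar>s - t\<bar> < 1/2 \<and> h t = H s"
      by (intro exI[of _ s]) (simp add: h_def abs_if)
  next
    fix c assume odd: "\<And>x. 0 \<le> x \<Longrightarrow> x \<le> 1/2 \<Longrightarrow> H (c + x) + H (c - x) = 2 * H c"
    \<comment> \<open>The derivative of this function vanishes on \<open>[0, 1/2]\<close>, and \<open>?D (1/2) = h c - H c\<close>.\<close>
    let ?D = "\<lambda>x. F (c + x) - F (c - x) - 2 * H c * x"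
    have D: "(?D has_real_derivative H (c + x) + H (c - x) - 2 * H c) (at x)" for x
      by (auto intro!: derivative_eq_intros DERIV_chain2[OF F])
    obtain x where "0 < x" "x < 1/2" "?D (1/2) - ?D 0 = (1/2 - 0) * (H (c + x) + H (c - x) - 2 * H c)"
      using MVT2[of 0 "1/2" ?D, OF _ D] by auto
    then show "h c = H c" using odd[of x] by (simp add: h_def)
  qed
qed

text \<open>The average of a reparametrization has derivatives in the same convex set of slopes, but
  it may miss the prescribed values at \<open>0\<close> and \<open>n\<close>. So the function is first replaced by its
  chord on the first and on the last half unit, extended linearly beyond both ends. It is then odd
  around the two end points, on the width of the averaging window. Times move by at most 1: by less
  than one half in the averaging, and by at most one half in the replacement.\<close>

lemma track_smooth:
  assumes S: "slope_class S" and tr: "track S P 0 0 n m" and n: "1 \<le> n"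
  obtains h where "strict_mono h" "h differentiable_on UNIV" "h 0 = 0" "h n = m"
    and "\<And>t. deriv h t \<in> S"
    and "\<And>t. 0 \<le> t \<Longrightarrow> t \<le> n \<Longrightarrow> \<exists>s. \<bar>s - t\<bar> \<le> 1 \<and> 0 \<le> s \<and> s \<le> n \<and> P s (h t)"
proof -
  obtain H where H: "continuous_on {0..n} H" "slopes_in S {0..n} H"
     "H 0 = 0" "H n = m" "\<And>t. t \<in> {0..n} \<Longrightarrow> P t (H t)"
    using tr unfolding track_def by auto
  have conv: "convex S" and pos: "S \<subseteq> {0<..}" using S by (auto simp: slope_class_def)
  \<comment> \<open>slopes of the chords of \<open>H\<close> over \<open>[0, 1/2]\<close> and \<open>[n - 1/2, n]\<close>\<close>
  define p where "p = 2 * H (1/2)"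
  define q where "q = 2 * (m - H (n - 1/2))"
  have pS: "p \<in> S" using slopes_inD[OF H(2), of 0 "1/2"] n H(3) by (auto simp: p_def mult.commute)
  have qS: "q \<in> S" using slopes_inD[OF H(2), of "n - 1/2" n] n H(4) by (auto simp: q_def mult.commute)
  define A where "A t = 0 + p * (t - 0)" for t :: real
  define B where "B t = m + q * (t - n)" for t :: real
  define G1 where "G1 = (\<lambda>t. if t \<le> 1/2 then A t else H t)"
  define G where "G = (\<lambda>t. if t \<le> n - 1/2 then G1 t else B t)"
  have 1: "continuous_on ({..1/2} \<union> {1/2..n-1/2}) G1" "slopes_in S ({..1/2} \<union> {1/2..n-1/2}) G1"
    unfolding G1_def
    by (rule paste[OF conv]; (use n in \<open>auto simp: A_def p_def intro!: continuous_intros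
          continuous_on_subset[OF H(1)] slopes_in_subset[OF H(2)]\<close>)?;
        use slopes_in_linear[OF pS, of _ 0 0] in \<open>simp add: p_def\<close>)+
  have A1: "A (1/2) = H (1/2)" by (simp add: A_def p_def)
  have "continuous_on ({..n-1/2} \<union> {n-1/2..}) G" "slopes_in S ({..n-1/2} \<union> {n-1/2..}) G"
  proof -
    have un: "{..1/2} \<union> {1/2..n-1/2} = {..n-1/2}" using n by auto
    have eq: "G1 (n - 1/2) = B (n - 1/2)"
    proof (cases "n = 1")
      case True then show ?thesis using A1 by (simp add: G1_def B_def q_def field_simps)
    next
      case False then show ?thesis using n by (simp add: G1_def B_def q_def field_simps)
    qed
    have Bc: "continuous_on {n-1/2..} B" unfolding B_def by (intro continuous_intros)
    have Bs: "slopes_in S {n-1/2..} B" unfolding B_def by (rule slopes_in_linear[OF qS])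
    show "continuous_on ({..n-1/2} \<union> {n-1/2..}) G" "slopes_in S ({..n-1/2} \<union> {n-1/2..}) G"
      unfolding G_def by (rule paste[OF conv]; use 1 un eq Bc Bs in auto)+
  qed
  moreover have "{..n-1/2} \<union> {n-1/2..} = UNIV" by auto
  ultimately have G: "continuous_on UNIV G" "slopes_in S UNIV G" by auto
  have mG: "G s < G t" if "s < t" for s t using slopes_in_strict_mono[OF G(2) pos] that by auto
  have mH: "H s < H t" if "0 \<le> s" "s < t" "t \<le> n" for s t
    using slopes_in_strict_mono[OF H(2) pos] that by auto
  have Gmid: "G t = H t" if "1/2 \<le> t" "t \<le> n - 1/2" for t
  proof (cases "t = 1/2")
    case True
    show ?thesis using A1 n unfolding True by (simp add: G_def G1_def)
  qed (use that in \<open>simp add: G_def G1_def\<close>)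
  have Glow: "G t = p * t" if "t \<le> 1/2" for t
    using that n by (auto simp: G_def G1_def A_def)
  have Bmid: "B (n - 1/2) = H (n - 1/2)" by (simp add: B_def q_def field_simps)
  have Ghigh: "G t = m + q * (t - n)" if "t \<ge> n - 1/2" for t
  proof (cases "t = n - 1/2")
    case True
    then show ?thesis using Gmid[of t] Bmid n by (simp add: B_def)
  next
    case False then show ?thesis using that by (simp add: G_def B_def)
  qed
  obtain h where h: "\<And>t. (h has_real_derivative G (t + 1/2) - G (t - 1/2)) (at t)"
    and hG: "\<And>t. \<exists>s. \<bar>s - t\<bar> < 1/2 \<and> h t = G s"
    and hc: "\<And>c. (\<And>x. 0 \<le> x \<Longrightarrow> x \<le> 1/2 \<Longrightarrow> G (c + x) + G (c - x) = 2 * G c) \<Longrightarrow> h c = G c"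
    using box_average[OF G(1)] by blast
  have dS: "G (t + 1/2) - G (t - 1/2) \<in> S" for t
    using slopes_inD[OF G(2), of "t - 1/2" "t + 1/2"] by auto
  have sm: "strict_mono h"
  proof (rule strict_monoI)
    fix s t :: real assume "s < t"
    then show "h s < h t"
    proof (rule DERIV_pos_imp_increasing)
      fix x show "\<exists>y. (h has_real_derivative y) (at x) \<and> 0 < y"
        using h[of x] subsetD[OF pos dS[of x]] by auto
    qed
  qed
  have h0: "h 0 = 0" using hc[of 0] by (simp add: Glow)
  have hn: "h n = m" using hc[of n] by (simp add: Ghigh algebra_simps)
  show ?thesis
  proof (rule that[OF sm _ h0 hn])
    show "h differentiable_on UNIV"
      using h by (auto simp: differentiable_on_def real_differentiable_def)
    show "deriv h t \<in> S" for t using DERIV_imp_deriv[OF h] dS by simp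
    fix t assume t: "0 \<le> t" "t \<le> n"
    have "h 0 \<le> h t" "h t \<le> h n" using sm t by (auto simp: strict_mono_less_eq)
    then obtain s' where s': "0 \<le> s'" "s' \<le> n" "H s' = h t"
      using IVT'[of H 0 "h t" n] H h0 hn n by auto
    obtain s where s: "\<bar>s - t\<bar> < 1/2" "h t = G s" using hG by blast
    have "\<bar>s' - t\<bar> \<le> 1"
    proof -
      \<comment> \<open>\<open>G\<close> agrees with \<open>H\<close> in the middle, and on each end piece both take the same values\<close>
      consider "s < 1/2" | "1/2 \<le> s" "s \<le> n - 1/2" | "n - 1/2 < s" by linarith
      then show ?thesis
      proof cases
        case 1
        have "H s' < H (1/2)" using mG[OF 1] s s' Gmid[of "1/2"] n by simp
        then have "s' < 1/2" using mH[of "1/2" s'] s' by (cases s' "1/2::real" rule: linorder_cases) auto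
        then show ?thesis using s 1 s' t by linarith
      next
        case 2
        have "H s' = H s" using s s' Gmid[OF 2] by simp
        then have "s' = s" using mH[of s s'] mH[of s' s] s' 2 by (cases s s' rule: linorder_cases) auto
        then show ?thesis using s by simp
      next
        case 3
        have "H (n - 1/2) < H s'" using mG[OF 3] s s' Gmid[of "n - 1/2"] n by simp
        then have "n - 1/2 < s'" using mH[of s' "n - 1/2"] s'
          by (cases s' "n - 1/2" rule: linorder_cases) auto
        then show ?thesis using s 3 s' t by linarith
      qed
    qed
    then show "\<exists>s. \<bar>s - t\<bar> \<le> 1 \<and> 0 \<le> s \<and> s \<le> n \<and> P s (h t)"
      using s' H(5)[of s'] by (intro exI[of _ s']) auto
  qed
qed

section \<open>Words and distances in a group with generators\<close>

locale marked_group = group G for G (structure) +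
  fixes X :: "'c set" and f
  assumes gens: "generating_set G X f"
begin

abbreviation val where "val \<equiv> word_val G f"

lemma gen_closed [simp]: "x \<in> X \<Longrightarrow> f x \<in> carrier G"
  using gens unfolding generating_set_def by blast

lemma gen_inv: "x \<in> X \<Longrightarrow> \<exists>y\<in>X. f y = inv (f x)"
  using gens unfolding generating_set_def by blast

lemma val_Nil [simp]: "val [] = \<one>" and val_Cons [simp]: "val (x # w) = f x \<otimes> val w"
  by (auto simp: word_val_def)

lemma val_closed [simp]: "w \<in> lists X \<Longrightarrow> val w \<in> carrier G"
  by (induction w) auto

lemma val_append: "u \<in> lists X \<Longrightarrow> v \<in> lists X \<Longrightarrow> val (u @ v) = val u \<otimes> val v"
  by (induction u) (simp_all add: m_assoc)

lemma val_inverse: "w \<in> lists X \<Longrightarrow> \<exists>v\<in>lists X. val v = inv (val w) \<and> length v = length w"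
proof (induction w)
  case (Cons x w)
  then have x: "x \<in> X" and w: "w \<in> lists X" by auto
  obtain v where v: "v \<in> lists X" "val v = inv (val w)" "length v = length w"
    using Cons.IH[OF w] by blast
  obtain y where y: "y \<in> X" "f y = inv (f x)" using gen_inv[OF x] by blast
  have "val (v @ [y]) = inv (val w) \<otimes> inv (f x)" using v y x w by (simp add: val_append)
  also have "\<dots> = inv (val (x # w))" using x w by (simp add: inv_mult_group)
  finally show ?case using v y by (intro bexI[of _ "v @ [y]"]) auto
qed auto

lemma val_onto: assumes "g \<in> carrier G" obtains w where "w \<in> lists X" "val w = g"
proof -
  have "g \<in> generate G (f ` X)" using assms gens unfolding generating_set_def by simp
  then have "\<exists>w\<in>lists X. val w = g"
  proof induction
    case one show ?case by (intro bexI[of _ "[]"]) auto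
  next
    case (incl h)
    then obtain x where "x \<in> X" "h = f x" by blast
    then show ?case by (intro bexI[of _ "[x]"]) auto
  next
    case (inv h)
    then obtain x y where "x \<in> X" "h = f x" "y \<in> X" "f y = inv (f x)" using gen_inv by blast
    then show ?case by (intro bexI[of _ "[y]"]) auto
  next
    case (eng g h)
    then obtain u v where "u \<in> lists X" "val u = g" "v \<in> lists X" "val v = h" by blast
    then show ?case by (intro bexI[of _ "u @ v"]) (auto simp: val_append)
  qed
  then show ?thesis using that by blast
qed

abbreviation cdist :: "'a \<Rightarrow> 'a \<Rightarrow> real" where
  "cdist g h \<equiv> real (cayley_dist G X f g h)"

text \<open>Edge paths are words, so distances can be estimated and attained by words.\<close>

lemma edge_path_iff:
  assumes "g \<in> carrier G"
  shows "(g, h) \<in> cayley_edges G X f ^^ n \<longleftrightarrow> (\<exists>w\<in>lists X. length w = n \<and> h = g \<otimes> val w)"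
  using assms
proof (induction n arbitrary: h)
  case (Suc n)
  show ?case
  proof
    assume "(g, h) \<in> cayley_edges G X f ^^ Suc n"
    then obtain k where "(g, k) \<in> cayley_edges G X f ^^ n" "(k, h) \<in> cayley_edges G X f"
      by auto
    moreover obtain w where "w \<in> lists X" "length w = n" "k = g \<otimes> val w"
      using Suc.IH[of k] Suc.prems calculation(1) by blast
    moreover obtain x where "h = k \<otimes> f x" "x \<in> X"
      using calculation(2) unfolding cayley_edges_def by blast
    ultimately show "\<exists>w\<in>lists X. length w = Suc n \<and> h = g \<otimes> val w"
      using Suc.prems by (intro bexI[of _ "w @ [x]"]) (auto simp: val_append m_assoc)
  next
    assume "\<exists>w\<in>lists X. length w = Suc n \<and> h = g \<otimes> val w"
    then obtain w where w: "w \<in> lists X" "length w = Suc n" "h = g \<otimes> val w" by blast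
    then obtain u x where ux: "w = u @ [x]" by (cases w rule: rev_cases) auto
    with w Suc have "(g, g \<otimes> val u) \<in> cayley_edges G X f ^^ n" by auto
    moreover have "h = g \<otimes> val u \<otimes> f x" "x \<in> X" "g \<otimes> val u \<in> carrier G"
      using w ux Suc.prems by (auto simp: val_append m_assoc)
    then have "(g \<otimes> val u, h) \<in> cayley_edges G X f"
      unfolding cayley_edges_def by blast
    ultimately show "(g, h) \<in> cayley_edges G X f ^^ Suc n" by auto
  qed
qed auto

lemma cayley_dist_le:
  assumes "g \<in> carrier G" "w \<in> lists X" "h = g \<otimes> val w"
  shows "cayley_dist G X f g h \<le> length w"
  unfolding cayley_dist_def by (rule Least_le) (use assms edge_path_iff in blast)

lemma cayley_dist_word:
  assumes "g \<in> carrier G" "h \<in> carrier G"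
  obtains w where "w \<in> lists X" "h = g \<otimes> val w" "cayley_dist G X f g h = length w"
proof -
  obtain w where "w \<in> lists X" "val w = inv g \<otimes> h"
    using val_onto[of "inv g \<otimes> h"] assms by blast
  then have "(g, h) \<in> cayley_edges G X f ^^ length w"
    unfolding edge_path_iff[OF assms(1)] using assms by (intro bexI[of _ w]) (auto simp: m_assoc[symmetric])
  then have "(g, h) \<in> cayley_edges G X f ^^ cayley_dist G X f g h"
    unfolding cayley_dist_def by (rule LeastI)
  then obtain w where "w \<in> lists X" "length w = cayley_dist G X f g h" "h = g \<otimes> val w"
    unfolding edge_path_iff[OF assms(1)] by blast
  then show ?thesis by (intro that) auto
qed

lemma cdist_self [simp]: "g \<in> carrier G \<Longrightarrow> cayley_dist G X f g g = 0"
  using cayley_dist_le[of g "[]" g] by simp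

lemma cdist_triangle:
  assumes "g \<in> carrier G" "h \<in> carrier G" "k \<in> carrier G"
  shows "cdist g k \<le> cdist g h + cdist h k"
proof -
  obtain u where "u \<in> lists X" "h = g \<otimes> val u" "cayley_dist G X f g h = length u"
    by (rule cayley_dist_word[OF assms(1,2)])
  moreover obtain v where "v \<in> lists X" "k = h \<otimes> val v" "cayley_dist G X f h k = length v"
    by (rule cayley_dist_word[OF assms(2,3)])
  ultimately show ?thesis
    using cayley_dist_le[of g "u @ v" k] assms by (simp add: val_append m_assoc)
qed

lemma cdist_sym:
  assumes "g \<in> carrier G" "h \<in> carrier G"
  shows "cayley_dist G X f g h = cayley_dist G X f h g"
proof -
  have "cayley_dist G X f h g \<le> cayley_dist G X f g h"
    if gh: "g \<in> carrier G" "h \<in> carrier G" for g h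
  proof -
    obtain u where u: "u \<in> lists X" "h = g \<otimes> val u" "cayley_dist G X f g h = length u"
      by (rule cayley_dist_word[OF gh])
    obtain v where v: "v \<in> lists X" "val v = inv (val u)" "length v = length u"
      using val_inverse u by blast
    have "g = h \<otimes> val v" using u v gh by (simp add: m_assoc)
    then show ?thesis using cayley_dist_le[OF gh(2) v(1)] u(3) v(3) by metis
  qed
  from this[of g h] this[of h g] show ?thesis using assms by linarith
qed

lemma cdist_gen: "g \<in> carrier G \<Longrightarrow> x \<in> X \<Longrightarrow> cdist g (g \<otimes> f x) \<le> 1"
  using cayley_dist_le[of g "[x]" "g \<otimes> f x"] by simp

text \<open>The last vertex that the path of \<open>w\<close> has passed at time \<open>t\<close>.\<close>

definition pos :: "'c list \<Rightarrow> real \<Rightarrow> 'a" where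
  "pos w t = val (take (nat \<lfloor>t\<rfloor>) w)"

lemma take_lists: "w \<in> lists X \<Longrightarrow> take k w \<in> lists X"
  by (meson in_listsD in_listsI in_set_takeD)

lemma pos_closed [simp]: "w \<in> lists X \<Longrightarrow> pos w t \<in> carrier G"
  by (simp add: pos_def take_lists)

lemma pos_low [simp]: "t < 1 \<Longrightarrow> pos w t = \<one>"
  by (simp add: pos_def)

lemma pos_high [simp]: "real (length w) \<le> t \<Longrightarrow> pos w t = val w"
  by (simp add: pos_def le_nat_floor)

lemma pos_Nil [simp]: "pos [] t = \<one>"
  by (simp add: pos_def)

lemma pos_lipschitz_nat:
  assumes "w \<in> lists X" "i \<le> j"
  shows "cdist (val (take i w)) (val (take j w)) \<le> real (j - i)"
proof -
  have "take j w = take i w @ drop i (take j w)"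
    using assms(2) by (metis append_take_drop_id min.absorb1 take_take)
  moreover have "drop i (take j w) \<in> lists X"
    using assms(1) by (meson in_listsD in_listsI in_set_dropD in_set_takeD)
  ultimately have "val (take j w) = val (take i w) \<otimes> val (drop i (take j w))"
    using val_append[of "take i w" "drop i (take j w)"] take_lists[OF assms(1)] by simp
  then have "cayley_dist G X f (val (take i w)) (val (take j w)) \<le> length (drop i (take j w))"
    by (intro cayley_dist_le) (use assms \<open>drop i (take j w) \<in> lists X\<close> in \<open>auto simp: take_lists\<close>)
  also have "\<dots> \<le> j - i" by simp
  finally show ?thesis by linarith
qed

lemma pos_lipschitz:
  assumes "w \<in> lists X" shows "cdist (pos w s) (pos w t) \<le> \<bar>s - t\<bar> + 1"
proof -
  have *: "cdist (pos w s) (pos w t) \<le> \<bar>s - t\<bar> + 1" if "s \<le> t" for s t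
  proof -
    have "nat \<lfloor>s\<rfloor> \<le> nat \<lfloor>t\<rfloor>" using that by (intro nat_mono floor_mono)
    then have "cdist (pos w s) (pos w t) \<le> real (nat \<lfloor>t\<rfloor> - nat \<lfloor>s\<rfloor>)"
      unfolding pos_def by (rule pos_lipschitz_nat[OF assms])
    also have "\<dots> \<le> \<bar>s - t\<bar> + 1" using that by linarith
    finally show ?thesis .
  qed
  show ?thesis
  proof (cases "s \<le> t")
    case True then show ?thesis by (rule *)
  next
    case False then show ?thesis using *[of t s] cdist_sym[of "pos w s" "pos w t"] assms by auto
  qed
qed

text \<open>Each exit of a point on the path is at most one edge away from the vertex passed last.\<close>

lemma exits_word_path:
  fixes w :: "'c list" and t :: real
  assumes "w \<in> lists X" "0 \<le> t"
  shows "\<exists>a. (pos w t, a) \<in> exits G f (word_path G f w t)"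
    and "finite (exits G f (word_path G f w t))"
    and "\<And>g a. (g, a) \<in> exits G f (word_path G f w t) \<Longrightarrow>
      g \<in> carrier G \<and> 0 \<le> a \<and> a \<le> 1 \<and> cdist g (pos w t) \<le> 1"
proof -
  let ?i = "nat \<lfloor>t\<rfloor>"
  consider (edge) "t < length w" | (vertex) "length w \<le> t" by linarith
  then have "(\<exists>a. (pos w t, a) \<in> exits G f (word_path G f w t))
    \<and> finite (exits G f (word_path G f w t))
    \<and> (\<forall>(g, a) \<in> exits G f (word_path G f w t).
         g \<in> carrier G \<and> 0 \<le> a \<and> a \<le> 1 \<and> cdist g (pos w t) \<le> 1)"
  proof cases
    case edge
    then have "?i < length w" using assms(2) by (simp add: floor_less_iff nat_less_iff)
    then have x: "w ! ?i \<in> X" using assms(1) by auto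
    have wp: "word_path G f w t = OnEdge (pos w t) (w ! ?i) (frac t)"
      using edge by (simp add: word_path_def pos_def)
    have "cdist (pos w t \<otimes> f (w ! ?i)) (pos w t) \<le> 1"
      using cdist_gen[of "pos w t" "w ! ?i"] cdist_sym[of "pos w t" "pos w t \<otimes> f (w ! ?i)"] x assms
      by simp
    then show ?thesis unfolding wp using x assms by (simp add: frac_lt_1 less_imp_le) blast
  next
    case vertex
    then show ?thesis using assms by (simp add: word_path_def)
  qed
  then show "\<exists>a. (pos w t, a) \<in> exits G f (word_path G f w t)"
    and "finite (exits G f (word_path G f w t))"
    and "\<And>g a. (g, a) \<in> exits G f (word_path G f w t) \<Longrightarrow>
      g \<in> carrier G \<and> 0 \<le> a \<and> a \<le> 1 \<and> cdist g (pos w t) \<le> 1"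
    by blast+
qed

text \<open>This replaces the path metric by the word metric on vertices, at the price of a constant.\<close>

lemma path_dist_diff:
  fixes v w :: "'c list" and s t :: real
  assumes "v \<in> lists X" "w \<in> lists X" "0 \<le> s" "0 \<le> t"
  defines "D \<equiv> path_dist G X f (word_path G f v s) (word_path G f w t)"
  shows "0 \<le> D" "D \<le> cdist (pos v s) (pos w t) + 2" "cdist (pos v s) (pos w t) \<le> D + 2"
proof -
  note ex = exits_word_path
  let ?p = "word_path G f v s" and ?q = "word_path G f w t"
  let ?A = "(\<lambda>((g, a), (h, b)). a + cdist g h + b) ` (exits G f ?p \<times> exits G f ?q)"
  let ?B = "{\<bar>s - r\<bar> | g x s r. ?p = OnEdge g x s \<and> ?q = OnEdge g x r}"
  have D: "D = Min (?A \<union> ?B)" by (simp add: D_def path_dist_def)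
  have "?B \<subseteq> {\<bar>frac s - frac t\<bar>}" by (auto simp: word_path_def split: if_splits)
  then have fin: "finite (?A \<union> ?B)" 
    using ex(2)[OF assms(1,3)] ex(2)[OF assms(2,4)] by (auto intro: finite_subset)
  obtain a b where ab: "(pos v s, a) \<in> exits G f ?p" "(pos w t, b) \<in> exits G f ?q"
    using ex(1)[of v s] ex(1)[of w t] assms by blast
  have le: "a \<le> 1" "b \<le> 1" using ex(3)[of v s] ex(3)[of w t] ab assms by blast+
  have inA: "a + cdist (pos v s) (pos w t) + b \<in> ?A \<union> ?B" using ab by force
  then have "D \<le> a + cdist (pos v s) (pos w t) + b" unfolding D by (intro Min_le fin)
  then show "D \<le> cdist (pos v s) (pos w t) + 2" using le by linarith
  have "D \<in> ?A \<union> ?B" unfolding D by (rule Min_in[OF fin]) (use inA in blast)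
  then have "0 \<le> D \<and> cdist (pos v s) (pos w t) \<le> D + 2"
  proof
    assume "D \<in> ?A"
    then obtain g a h b where gh: "(g, a) \<in> exits G f ?p" "(h, b) \<in> exits G f ?q" and D: "D = a + cdist g h + b"
      by auto
    have 1: "g \<in> carrier G" "0 \<le> a" "cdist g (pos v s) \<le> 1" using ex(3)[OF _ _ gh(1)] assms by auto
    have 2: "h \<in> carrier G" "0 \<le> b" "cdist h (pos w t) \<le> 1" using ex(3)[OF _ _ gh(2)] assms by auto
    have "cdist (pos v s) (pos w t) \<le> cdist (pos v s) g + (cdist g h + cdist h (pos w t))"
      using cdist_triangle[of "pos v s" g "pos w t"] cdist_triangle[of g h "pos w t"] 1 2 assms by auto
    then show ?thesis using 1 2 D cdist_sym[of g "pos v s"] assms by auto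
  next
    assume "D \<in> ?B"
    then have "0 \<le> D" "pos v s = pos w t" by (auto simp: word_path_def pos_def split: if_splits)
    then show ?thesis using assms by auto
  qed
  then show "0 \<le> D" "cdist (pos v s) (pos w t) \<le> D + 2" by auto
qed

end

section \<open>Coarse fellow travelling\<close>

lemma strict_mono_image_ends:
  fixes h :: "real \<Rightarrow> real"
  assumes "strict_mono h" "h ` A = B" "a \<in> A" "b \<in> B"
  shows "(\<And>t. t \<in> A \<Longrightarrow> a \<le> t) \<Longrightarrow> (\<And>s. s \<in> B \<Longrightarrow> b \<le> s) \<Longrightarrow> h a = b"
    and "(\<And>t. t \<in> A \<Longrightarrow> t \<le> a) \<Longrightarrow> (\<And>s. s \<in> B \<Longrightarrow> s \<le> b) \<Longrightarrow> h a = b"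
proof -
  obtain t where t: "t \<in> A" "h t = b" using assms by blast
  have ha: "h a \<in> B" using assms by blast
  show "h a = b" if "\<And>t. t \<in> A \<Longrightarrow> a \<le> t" "\<And>s. s \<in> B \<Longrightarrow> b \<le> s"
    using that(1)[OF t(1)] that(2)[OF ha] t(2) strict_mono_less_eq[OF assms(1), of a t] by simp
  show "h a = b" if "\<And>t. t \<in> A \<Longrightarrow> t \<le> a" "\<And>s. s \<in> B \<Longrightarrow> s \<le> b"
    using that(1)[OF t(1)] that(2)[OF ha] t(2) strict_mono_less_eq[OF assms(1), of t a] by simp
qed

lemma reparametrization_ends:
  assumes "reparametrization v w h"
  shows "h 0 = 0" and "(v = [] \<longleftrightarrow> w = []) \<Longrightarrow> h (length v) = length w"
proof -
  have sm: "strict_mono h" using assms by (simp add: reparametrization_def)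
  show "h 0 = 0"
  proof (cases "v = [] \<longleftrightarrow> w = []")
    case True
    then have "h ` {0..real (length v)} = {0..real (length w)}"
      using assms by (simp add: reparametrization_def)
    then show ?thesis by (rule strict_mono_image_ends(1)[OF sm]) auto
  next
    case False
    then have "h ` {0..} = {0..}" using assms by (auto simp: reparametrization_def)
    then show ?thesis by (rule strict_mono_image_ends(1)[OF sm]) auto
  qed
  show "h (length v) = length w" if "v = [] \<longleftrightarrow> w = []"
  proof -
    have "h ` {0..real (length v)} = {0..real (length w)}"
      using assms that by (simp add: reparametrization_def)
    then show ?thesis by (rule strict_mono_image_ends(2)[OF sm]) auto
  qed
qed

context marked_group
begin

text \<open>Fellow travelling up to constants, in terms of vertices and continuous reparametrizations. When
  just one of the words is empty, all times of the other one are matched with the identity, so no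
  reparametrization is involved.\<close>

definition fellow :: "real set \<Rightarrow> real \<Rightarrow> 'c list \<Rightarrow> 'c list \<Rightarrow> bool" where
  "fellow S K v w \<longleftrightarrow>
     (if v = [] \<longleftrightarrow> w = []
      then track S (\<lambda>t s. cdist (pos v t) (pos w s) \<le> K) 0 0 (length v) (length w)
      else \<forall>t. cdist (pos v t) (pos w t) \<le> K)"

lemma fellow_ends:
  assumes "fellow S K v w" shows "cdist (val v) (val w) \<le> K" "0 \<le> K"
proof -
  show "cdist (val v) (val w) \<le> K"
  proof (cases "v = [] \<longleftrightarrow> w = []")
    case True
    then show ?thesis using track_ends(2)[of S _ 0 0 "length v" "length w"] assms
      by (fastforce simp: fellow_def)
  next
    case False
    let ?T = "real (length v + length w)"
    have "cdist (pos v ?T) (pos w ?T) \<le> K" using False assms unfolding fellow_def by meson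
    moreover have "pos v ?T = val v" "pos w ?T = val w" by (intro pos_high; simp)+
    ultimately show ?thesis by (simp only:)
  qed
  then show "0 \<le> K" by (rule order_trans[OF of_nat_0_le_iff])
qed

lemma fellow_sym:
  assumes "slope_class S" "v \<in> lists X" "w \<in> lists X" "fellow S K v w"
  shows "fellow S K w v"
proof -
  have sym: "cdist (pos v t) (pos w s) = cdist (pos w s) (pos v t)" for s t
    using cdist_sym assms(2,3) by simp
  show ?thesis
  proof (cases "v = [] \<longleftrightarrow> w = []")
    case True
    then have "track S (\<lambda>t s. cdist (pos v t) (pos w s) \<le> K) 0 0 (length v) (length w)"
      using assms(4) unfolding fellow_def by simp
    from track_sym[OF assms(1) this] show ?thesis
      using True unfolding fellow_def sym by simp
  next
    case False
    then show ?thesis using assms(4) unfolding fellow_def by (auto simp: sym)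
  qed
qed

lemma fellow_perturb:
  assumes "S \<subseteq> {0<..}" "v \<in> lists X" "v' \<in> lists X" "w \<in> lists X"
    and "length v' = length v" "\<And>t. cdist (pos v' t) (pos v t) \<le> C"
    and "fellow S K v w"
  shows "fellow S (K + C) v' w"
proof -
  have *: "cdist (pos v' t) (pos w s) \<le> K + C" if "cdist (pos v t) (pos w s) \<le> K" for s t
    using that assms(6)[of t] cdist_triangle[of "pos v' t" "pos v t" "pos w s"] assms(2-4) by simp
  have "v' = [] \<longleftrightarrow> v = []" using assms(5) by auto
  show ?thesis
  proof (cases "v = [] \<longleftrightarrow> w = []")
    case True
    then have "track S (\<lambda>t s. cdist (pos v t) (pos w s) \<le> K) 0 0 (length v) (length w)"
      using assms(7) unfolding fellow_def by simp
    then have "track S (\<lambda>t s. cdist (pos v' t) (pos w s) \<le> K + C) 0 0 (length v) (length w)"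
      by (rule track_mono[OF _ order_refl assms(1)]) (rule *)
    then show ?thesis using True \<open>v' = [] \<longleftrightarrow> v = []\<close> assms(5) unfolding fellow_def by simp
  next
    case False
    then have "\<forall>t. cdist (pos v t) (pos w t) \<le> K" using assms(7) unfolding fellow_def by meson
    then show ?thesis using * False \<open>v' = [] \<longleftrightarrow> v = []\<close> unfolding fellow_def by auto
  qed
qed

text \<open>The times \<open>t \<le> 0\<close>, about which fellow travelling says nothing, cause no problem: both paths are
  then at the identity.\<close>

lemma reparametrization_imp_fellow:
  assumes vw: "v \<in> lists X" "w \<in> lists X" and h: "reparametrization v w h"
    and d: "\<And>t. t > 0 \<Longrightarrow> path_dist G X f (word_path G f v t) (word_path G f w (h t)) \<le> K"
    and S: "slopes_in S {0..length v} h"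
  shows "fellow S (K + 2) v w"
proof -
  have sm: "strict_mono h" and diff: "h differentiable_on UNIV" using h by (auto simp: reparametrization_def)
  have h0: "h 0 = 0" using reparametrization_ends[OF h] by simp
  have hpos: "0 < h t" if "0 < t" for t using strict_monoD[OF sm that] h0 by simp
  have near: "cdist (pos v t) (pos w (h t)) \<le> K + 2" if "t > 0" for t
    using path_dist_diff(3)[OF vw less_imp_le[OF that] less_imp_le[OF hpos[OF that]]] d[OF that]
    by linarith
  have K: "0 \<le> K + 2" by (rule order_trans[OF of_nat_0_le_iff near[of 1]]) simp
  show ?thesis
  proof (cases "v = [] \<longleftrightarrow> w = []")
    case True
    have "cdist (pos v t) (pos w (h t)) \<le> K + 2" if "t \<ge> 0" for t
    proof (cases "t = 0")
      case True
      then show ?thesis using K h0 by simp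
    next
      case False
      then show ?thesis using near[of t] that by simp
    qed
    moreover have "continuous_on {0..real (length v)} h"
      by (rule continuous_on_subset[OF differentiable_imp_continuous_on[OF diff] subset_UNIV])
    ultimately have "track S (\<lambda>t s. cdist (pos v t) (pos w s) \<le> K + 2) 0 0 (length v) (length w)"
      unfolding track_def using h0 S reparametrization_ends(2)[OF h True]
      by (intro exI[of _ h]) auto
    then show ?thesis using True by (simp add: fellow_def)
  next
    case False
    then have img: "h ` {0..} = {0..}" using h by (auto simp: reparametrization_def)
    have "cdist (pos v t) (pos w t) \<le> K + 2" for t
    proof (cases "t < 1")
      case True then show ?thesis using K by simp
    next
      case t: False
      then have "t \<in> h ` {0..}" unfolding img by simp
      then obtain s where s: "s \<ge> 0" "h s = t" by auto
      then have "s > 0" using t h0 by (cases "s = 0") auto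
      have ns: "cdist (pos v s) (pos w t) \<le> K + 2" using near[OF \<open>s > 0\<close>] s(2) by simp
      show ?thesis
      proof (cases "v = []")
        case True
        then show ?thesis using ns by simp
      next
        case v: False
        then show ?thesis using near[of t] t False by simp
      qed
    qed
    then show ?thesis using False by (simp add: fellow_def)
  qed
qed

lemma fellow_imp_reparametrization:
  assumes vw: "v \<in> lists X" "w \<in> lists X" and S: "slope_class S" and fe: "fellow S K v w"
  obtains h where "reparametrization v w h" "\<And>t. deriv h t \<in> S"
    "\<And>t. t > 0 \<Longrightarrow> path_dist G X f (word_path G f v t) (word_path G f w (h t)) \<le> K + 4"
proof (cases "v \<noteq> [] \<and> w \<noteq> []")
  case True
  then have n: "1 \<le> real (length v)" by (cases v) auto
  have "track S (\<lambda>t s. cdist (pos v t) (pos w s) \<le> K) 0 0 (length v) (length w)"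
    using True fe by (simp add: fellow_def)
  then obtain h :: "real \<Rightarrow> real" where sm: "strict_mono h" and diff: "h differentiable_on UNIV"
    and h0: "h 0 = 0" and hn: "h (length v) = length w" and dS: "\<And>t. deriv h t \<in> S"
    and near: "\<And>t. 0 \<le> t \<Longrightarrow> t \<le> real (length v) \<Longrightarrow>
      \<exists>s. \<bar>s - t\<bar> \<le> 1 \<and> 0 \<le> s \<and> s \<le> real (length v) \<and> cdist (pos v s) (pos w (h t)) \<le> K"
    by (rule track_smooth[OF S _ n]) (rule that; assumption)
  have "h ` {0..real (length v)} = {0..real (length w)}"
  proof
    show "h ` {0..real (length v)} \<subseteq> {0..real (length w)}"
    proof (rule image_subsetI)
      fix t assume "t \<in> {0..real (length v)}"
      then show "h t \<in> {0..real (length w)}"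
        using strict_mono_less_eq[OF sm, of 0 t] strict_mono_less_eq[OF sm, of t "length v"] h0 hn
        by simp
    qed
    show "{0..real (length w)} \<subseteq> h ` {0..real (length v)}"
    proof
      fix s assume "s \<in> {0..real (length w)}"
      moreover have "continuous_on {0..real (length v)} h"
        by (rule continuous_on_subset[OF differentiable_imp_continuous_on[OF diff] subset_UNIV])
      ultimately obtain t where "0 \<le> t" "t \<le> real (length v)" "h t = s"
        using IVT'[of h 0 s "length v"] h0 hn by auto
      then show "s \<in> h ` {0..real (length v)}" by auto
    qed
  qed
  then have "reparametrization v w h" using sm diff True by (simp add: reparametrization_def)
  moreover have "path_dist G X f (word_path G f v t) (word_path G f w (h t)) \<le> K + 4" if "t > 0" for t
  proof -
    have ht: "0 \<le> h t" using strict_monoD[OF sm that] h0 by simp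
    have "cdist (pos v t) (pos w (h t)) \<le> K + 2"
    proof (cases "t \<le> length v")
      case True
      then obtain s where s: "\<bar>s - t\<bar> \<le> 1" "cdist (pos v s) (pos w (h t)) \<le> K"
        using near[OF less_imp_le[OF \<open>t > 0\<close>] True] by blast
      then show ?thesis
        using pos_lipschitz[OF vw(1), of t s] cdist_triangle[of "pos v t" "pos v s" "pos w (h t)"] vw
        by (simp add: abs_minus_commute)
    next
      case False
      then have "length w \<le> h t" using strict_monoD[OF sm, of "length v" t] hn by simp
      then show ?thesis using False fellow_ends(1)[OF fe] by simp
    qed
    then show ?thesis using path_dist_diff(2)[OF vw less_imp_le[OF that] ht] by linarith
  qed
  ultimately show ?thesis using that dS by blast
next
  case False
  have id: "reparametrization v w (\<lambda>t. t)"
  proof -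
    have "strict_mono (\<lambda>t::real. t)" by (simp add: strict_mono_def)
    moreover have "(\<lambda>t::real. t) differentiable_on UNIV" by (simp add: differentiable_on_def)
    ultimately show ?thesis using False by (auto simp: reparametrization_def)
  qed
  have d: "cdist (pos v t) (pos w t) \<le> K" for t
    using False fe fellow_ends(2)[OF fe] by (cases "v = [] \<longleftrightarrow> w = []") (auto simp: fellow_def)
  show ?thesis
  proof (rule that[OF id])
    show "deriv (\<lambda>t. t) t \<in> S" for t :: real using S by (simp add: slope_class_def)
    show "path_dist G X f (word_path G f v t) (word_path G f w t) \<le> K + 4" if "t > 0" for t
      using path_dist_diff(2)[OF vw less_imp_le[OF that] less_imp_le[OF that]] d[of t] by linarith
  qed
qed

lemma async_imp_fellow:
  assumes "v \<in> lists X" "w \<in> lists X" "async_fellow_travel G X f K v w"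
  shows "fellow {0<..} (K + 2) v w"
proof -
  obtain h where h: "reparametrization v w h"
    and "\<And>t. t > 0 \<Longrightarrow> path_dist G X f (word_path G f v t) (word_path G f w (h t)) \<le> K"
    using assms(3) unfolding async_fellow_travel_def by blast
  moreover have "slopes_in {0<..} {0..length v} h"
    unfolding slopes_in_def
  proof (intro ballI impI)
    fix s t :: real assume "s < t"
    moreover have "h s < h t"
      using h strict_monoD[OF _ \<open>s < t\<close>] unfolding reparametrization_def by blast
    ultimately show "(h t - h s) / (t - s) \<in> {0<..}" by simp
  qed
  ultimately show ?thesis by (rule reparametrization_imp_fellow[OF assms(1,2)])
qed

lemma fellow_imp_async:
  assumes "v \<in> lists X" "w \<in> lists X" "fellow {0<..} K v w"
  shows "async_fellow_travel G X f (K + 4) v w"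
  by (rule fellow_imp_reparametrization[OF assms(1,2) slope_class_pos assms(3)])
     (auto simp: async_fellow_travel_def)

text \<open>The mean value theorem turns bounds on the derivative into bounds on chord slopes. A
  strictly increasing function has a positive derivative somewhere on \<open>[-1, 0]\<close>, which rules out
  \<open>M \<le> 0\<close>; then \<open>1 / M \<le> M\<close> gives \<open>M \<ge> 1\<close>.\<close>

lemma bounded_async_imp_fellow:
  assumes "v \<in> lists X" "w \<in> lists X" "bounded_async_fellow_travel G X f K M v w"
  shows "1 \<le> M" "fellow {1/M..M} (K + 2) v w"
proof -
  obtain h where h: "reparametrization v w h"
    and d: "\<And>t. t > 0 \<Longrightarrow> path_dist G X f (word_path G f v t) (word_path G f w (h t)) \<le> K"
    and b: "\<And>t. t \<le> real (length v) \<Longrightarrow> 1 / M \<le> deriv h t \<and> deriv h t \<le> M"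
    using assms(3) unfolding bounded_async_fellow_travel_def by blast
  have D: "(h has_real_derivative deriv h t) (at t)" for t
    using h by (simp add: reparametrization_def differentiable_on_def
        DERIV_deriv_iff_real_differentiable)
  have mvt: "\<exists>z. z < t \<and> h t - h s = (t - s) * deriv h z" if "s < t" for s t
    using MVT2[OF that, of h "deriv h"] D by blast
  have sm: "strict_mono h" using h by (simp add: reparametrization_def)
  obtain z where "z < 0" "h 0 - h (-1) = deriv h z" using mvt[of "-1" 0] by auto
  moreover have "h (-1) < h 0" using strict_monoD[OF sm] by simp
  ultimately have "0 < M" "1 / M \<le> M" using b[of z] by auto
  then show "1 \<le> M"
    by (smt (verit) divide_le_eq_1_pos le_divide_eq_1_pos)
  have sl: "slopes_in {1/M..M} {0..length v} h"
    unfolding slopes_in_def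
  proof (intro ballI impI)
    fix s t assume st: "s \<in> {0..real (length v)}" "t \<in> {0..real (length v)}" "s < t"
    obtain z where "z < t" "h t - h s = (t - s) * deriv h z" using mvt st(3) by blast
    then show "(h t - h s) / (t - s) \<in> {1/M..M}" using b[of z] st by simp
  qed
  show "fellow {1/M..M} (K + 2) v w"
    by (rule reparametrization_imp_fellow[OF assms(1,2) h _ sl]) (rule d)
qed

lemma fellow_imp_bounded_async:
  assumes "v \<in> lists X" "w \<in> lists X" "1 \<le> M" "fellow {1/M..M} K v w"
  shows "bounded_async_fellow_travel G X f (K + 4) M v w"
  by (rule fellow_imp_reparametrization[OF assms(1,2) slope_class_bounded[OF assms(3)] assms(4)])
     (auto simp: bounded_async_fellow_travel_def)

lemma sync_imp_near:
  assumes "v \<in> lists X" "w \<in> lists X" "sync_fellow_travel G X f K v w"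
  shows "cdist (pos v t) (pos w t) \<le> K + 2"
proof (cases "0 \<le> t")
  case True
  then show ?thesis using path_dist_diff(3)[OF assms(1,2), of t t] assms(3)
    unfolding sync_fellow_travel_def by force
next
  case False
  have "0 \<le> K" using path_dist_diff(1)[OF assms(1,2), of 0 0] assms(3)
    unfolding sync_fellow_travel_def by force
  then show ?thesis using False by simp
qed

lemma near_imp_sync:
  assumes "v \<in> lists X" "w \<in> lists X" "\<And>t. 0 \<le> t \<Longrightarrow> cdist (pos v t) (pos w t) \<le> K"
  shows "sync_fellow_travel G X f (K + 2) v w"
  unfolding sync_fellow_travel_def
proof (intro allI impI)
  fix t :: real assume "0 \<le> t"
  then show "path_dist G X f (word_path G f v t) (word_path G f w t) \<le> K + 2"
    using path_dist_diff(2)[OF assms(1,2), of t t] assms(3)[of t] by simp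
qed

text \<open>If \<open>v\<close> is the shorter word, its path stops at time \<open>l(v)\<close> while that of \<open>w\<close> goes on near its end.
  The identity up to \<open>l(v) - 1/2\<close>, followed by a linear piece that runs through the rest of \<open>w\<close> during the
  last half unit, is a reparametrization, and \<open>v\<close> moves by at most one edge during that half unit.\<close>

lemma near_imp_fellow:
  assumes vw: "v \<in> lists X" "w \<in> lists X" and K: "\<And>t. cdist (pos v t) (pos w t) \<le> K"
  shows "fellow {0<..} (K + 2) v w"
proof -
  have *: "fellow {0<..} (K + 2) v w"
    if vw: "v \<in> lists X" "w \<in> lists X" and K: "\<And>t. cdist (pos v t) (pos w t) \<le> K"
      and le: "length v \<le> length w" for v w
  proof -
    consider "v = [] \<longleftrightarrow> w \<noteq> []" | "v = []" "w = []" | "v \<noteq> []" "w \<noteq> []" by auto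
    then show ?thesis
    proof cases
      case 1
      have "cdist (pos v t) (pos w t) \<le> K + 2" for t using K[of t] by linarith
      then show ?thesis using 1 by (auto simp: fellow_def)
    next
      case 2
      then show ?thesis using K[of 0] by (auto simp: fellow_def intro!: track_refl)
    next
      case 3
      let ?n = "real (length v)" and ?m = "real (length w)"
      let ?P = "\<lambda>t s. cdist (pos v t) (pos w s) \<le> K + 2"
      have n: "1 \<le> ?n" using 3 by (cases v) auto
      have "track {0<..} (\<lambda>t s. s = t) 0 0 (?n - 1/2) (?n - 1/2)"
        unfolding track_def using n
        by (intro exI[of _ "\<lambda>t. t"]) (auto simp: slopes_in_def)
      then have "track {0<..} ?P 0 0 (?n - 1/2) (?n - 1/2)"
      proof (rule track_mono)
        fix t s :: real assume "s = t"
        then show "?P t s" using K[of t] by simp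
      qed auto
      moreover have "track {0<..} ?P (?n - 1/2) (?n - 1/2) ?n ?m"
      proof (rule track_linear)
        fix t s assume t: "?n - 1/2 \<le> t" "t \<le> ?n" and s: "?n - 1/2 \<le> s" "s \<le> ?m"
        have s': "pos v s = pos v (min s ?n)" by (simp add: min_def)
        have "\<bar>t - min s ?n\<bar> \<le> 1" using t s by linarith
        then have "cdist (pos v t) (pos v s) \<le> 2"
          unfolding s' using pos_lipschitz[OF vw(1), of t "min s ?n"] by linarith
        then show "?P t s"
          using cdist_triangle[of "pos v t" "pos v s" "pos w s"] K[of s] vw by simp
      qed (use le in auto)
      ultimately have "track {0<..} ?P 0 0 ?n ?m" by (rule track_join[rotated]) simp
      then show ?thesis using 3 by (simp add: fellow_def)
    qed
  qed
  show ?thesis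
  proof (cases "length v \<le> length w")
    case True then show ?thesis by (intro * vw K)
  next
    case False
    have "fellow {0<..} (K + 2) w v"
      by (rule *) (use False vw K cdist_sym in auto)
    then show ?thesis by (rule fellow_sym[OF slope_class_pos vw(2,1)])
  qed
qed

end

section \<open>The direct product\<close>

text \<open>A pair \<open>(g, h)\<close> is the product of \<open>(g, \<one>)\<close> and \<open>(\<one>, h)\<close>, and each of these two is spelled by a word over one
  of the generating sets.\<close>

lemma generating_set_DirProd:
  assumes "group G1" "group G2" and gen: "generating_set G1 X1 f1" "generating_set G2 X2 f2"
    and shared: "\<forall>x\<in>X1 \<inter> X2. f1 x = \<one>\<^bsub>G1\<^esub> \<and> f2 x = \<one>\<^bsub>G2\<^esub>"
  shows "generating_set (G1 \<times>\<times> G2) (X1 \<union> X2) (product_gens G1 G2 X1 f1 f2)"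
proof -
  let ?G = "G1 \<times>\<times> G2" and ?f = "product_gens G1 G2 X1 f1 f2" and ?X = "X1 \<union> X2"
  interpret A: marked_group G1 X1 f1
    by (intro marked_group.intro marked_group_axioms.intro assms)
  interpret B: marked_group G2 X2 f2
    by (intro marked_group.intro marked_group_axioms.intro assms)
  interpret group ?G by (rule DirProd_group) (fact assms)+
  have f1: "?f x = (f1 x, \<one>\<^bsub>G2\<^esub>)" if "x \<in> X1" for x
    using that by (simp add: product_gens_def)
  have f2: "?f x = (\<one>\<^bsub>G1\<^esub>, f2 x)" if "x \<in> X2" for x
    using that shared by (auto simp: product_gens_def)
  have closed: "?f ` ?X \<subseteq> carrier ?G" using f1 f2 by auto
  have inv: "\<exists>y\<in>?X. ?f y = inv\<^bsub>?G\<^esub> (?f x)" if "x \<in> ?X" for x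
    using that
  proof
    assume x: "x \<in> X1"
    then obtain y where "y \<in> X1" "f1 y = inv\<^bsub>G1\<^esub> (f1 x)" using A.gen_inv by blast
    then show ?thesis using x f1 by (intro bexI[of _ y]) (auto simp: inv_DirProd assms)
  next
    assume x: "x \<in> X2"
    then obtain y where "y \<in> X2" "f2 y = inv\<^bsub>G2\<^esub> (f2 x)" using B.gen_inv by blast
    then show ?thesis using x f2 by (intro bexI[of _ y]) (auto simp: inv_DirProd assms)
  qed
  have 1: "(word_val G1 f1 u, \<one>\<^bsub>G2\<^esub>) \<in> generate ?G (?f ` ?X)" if "u \<in> lists X1" for u
    using that
  proof induction
    case Nil
    then show ?case using generate.one[of ?G] by simp
  next
    case (Cons x u)
    have "(f1 x, \<one>\<^bsub>G2\<^esub>) \<in> generate ?G (?f ` ?X)"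
      using Cons f1[of x] by (intro generate.incl) (metis UnI1 imageI)
    from generate.eng[OF this Cons.IH] show ?case by simp
  qed
  have 2: "(\<one>\<^bsub>G1\<^esub>, word_val G2 f2 v) \<in> generate ?G (?f ` ?X)" if "v \<in> lists X2" for v
    using that
  proof induction
    case Nil
    then show ?case using generate.one[of ?G] by simp
  next
    case (Cons x v)
    have "(\<one>\<^bsub>G1\<^esub>, f2 x) \<in> generate ?G (?f ` ?X)"
      using Cons f2[of x] by (intro generate.incl) (metis UnI2 imageI)
    from generate.eng[OF this Cons.IH] show ?case by simp
  qed
  have "carrier ?G \<subseteq> generate ?G (?f ` ?X)"
  proof
    fix p assume "p \<in> carrier ?G"
    then obtain g h where p: "p = (g, h)" "g \<in> carrier G1" "h \<in> carrier G2" by auto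
    obtain u where u: "u \<in> lists X1" "word_val G1 f1 u = g" using A.val_onto p by blast
    obtain v where v: "v \<in> lists X2" "word_val G2 f2 v = h" using B.val_onto p by blast
    from generate.eng[OF 1[OF u(1)] 2[OF v(1)]] show "p \<in> generate ?G (?f ` ?X)"
      using p u v by simp
  qed
  moreover have "generate ?G (?f ` ?X) \<subseteq> carrier ?G"
    using generate_in_carrier[OF closed] by blast
  moreover have "finite ?X" using gen by (simp add: generating_set_def)
  ultimately show ?thesis using closed inv unfolding generating_set_def by blast
qed

locale marked_product =
  A: marked_group G1 X1 f1 + B: marked_group G2 X2 f2
  for G1 :: "('a, 'm) monoid_scheme" (structure) and X1 :: "'c set" and f1
    and G2 :: "('b, 'n) monoid_scheme" (structure) and X2 :: "'c set" and f2 +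
  assumes shared: "\<forall>x\<in>X1 \<inter> X2. f1 x = \<one>\<^bsub>G1\<^esub> \<and> f2 x = \<one>\<^bsub>G2\<^esub>"
begin

sublocale C: marked_group "G1 \<times>\<times> G2" "X1 \<union> X2" "product_gens G1 G2 X1 f1 f2"
  by (intro marked_group.intro marked_group_axioms.intro DirProd_group
      generating_set_DirProd A.is_group B.is_group A.gens B.gens shared)

lemma gens1: "x \<in> X1 \<Longrightarrow> product_gens G1 G2 X1 f1 f2 x = (f1 x, \<one>\<^bsub>G2\<^esub>)"
  by (simp add: product_gens_def)

lemma gens2: "x \<in> X2 \<Longrightarrow> product_gens G1 G2 X1 f1 f2 x = (\<one>\<^bsub>G1\<^esub>, f2 x)"
  using shared by (auto simp: product_gens_def)

lemma lists1: "u \<in> lists X1 \<Longrightarrow> u \<in> lists (X1 \<union> X2)"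
  and lists2: "v \<in> lists X2 \<Longrightarrow> v \<in> lists (X1 \<union> X2)"
  by auto

lemma val1: "u \<in> lists X1 \<Longrightarrow> C.val u = (A.val u, \<one>\<^bsub>G2\<^esub>)"
  by (induction u) (auto simp: gens1)

lemma val2: "v \<in> lists X2 \<Longrightarrow> C.val v = (\<one>\<^bsub>G1\<^esub>, B.val v)"
  by (induction v) (auto simp: gens2)

lemma val_concat:
  assumes "u \<in> lists X1" "v \<in> lists X2" shows "C.val (u @ v) = (A.val u, B.val v)"
  using assms C.val_append[OF lists1 lists2] by (simp add: val1 val2)

text \<open>At negative times a path is at the identity, so the formula covers the first part of the path,
  on which the second coordinate has not moved yet.\<close>

lemma pos_concat:
  assumes "u \<in> lists X1" "v \<in> lists X2"
  shows "C.pos (u @ v) t = (A.pos u t, B.pos v (t - length u))"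
proof -
  have "nat \<lfloor>t - real (length u)\<rfloor> = nat \<lfloor>t\<rfloor> - length u"
    by linarith
  then show ?thesis
    using val_concat[OF A.take_lists[OF assms(1)] B.take_lists[OF assms(2)]]
    by (simp add: C.pos_def A.pos_def B.pos_def)
qed

lemma cdist_product_le:
  assumes "g \<in> carrier G1" "g' \<in> carrier G1" "h \<in> carrier G2" "h' \<in> carrier G2"
  shows "C.cdist (g, h) (g', h') \<le> A.cdist g g' + B.cdist h h'"
proof -
  obtain u where u: "u \<in> lists X1" "g' = g \<otimes>\<^bsub>G1\<^esub> A.val u" "cayley_dist G1 X1 f1 g g' = length u"
    by (rule A.cayley_dist_word[OF assms(1,2)])
  obtain v where v: "v \<in> lists X2" "h' = h \<otimes>\<^bsub>G2\<^esub> B.val v" "cayley_dist G2 X2 f2 h h' = length v"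
    by (rule B.cayley_dist_word[OF assms(3,4)])
  have "cayley_dist (G1 \<times>\<times> G2) (X1 \<union> X2) (product_gens G1 G2 X1 f1 f2) (g, h) (g', h') \<le> length (u @ v)"
  proof (rule C.cayley_dist_le)
    show "u @ v \<in> lists (X1 \<union> X2)" using u(1) v(1) by auto
  qed (use u v assms val_concat[OF u(1) v(1)] in auto)
  then show ?thesis using u v by simp
qed

lemma cdist_concat_le:
  assumes "u \<in> lists X1" "u' \<in> lists X1" "v \<in> lists X2" "v' \<in> lists X2"
  shows "C.cdist (C.pos (u @ v) t) (C.pos (u' @ v') s)
    \<le> A.cdist (A.pos u t) (A.pos u' s) + B.cdist (B.pos v (t - length u)) (B.pos v' (s - length u'))"
  using assms by (simp add: pos_concat cdist_product_le)

end

section \<open>Fellow travelling of concatenated words\<close>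

context marked_group
begin

lemma pos_Cons:
  "pos (x # w) t = (if t < 1 then \<one> else f x \<otimes> pos w (t - 1))"
proof (cases "t < 1")
  case False
  then have "nat \<lfloor>t\<rfloor> = Suc (nat \<lfloor>t - 1\<rfloor>)" by linarith
  then show ?thesis using False by (simp add: pos_def)
qed simp

end

context marked_product
begin

text \<open>As \<open>x\<close> commutes with \<open>u\<close>, both words spell the same element from the end of \<open>u x\<close> on. Before that
  they differ in the second coordinate by at most \<open>x\<close>, and in the first one by a delay of one unit.\<close>

lemma pos_move_letter:
  assumes "u \<in> lists X1" "x \<in> X2" "v \<in> lists X2"
  shows "C.cdist (C.pos (x # u @ v) t) (C.pos (u @ x # v) t) \<le> 3"
proof (cases "t < 1")
  case True then show ?thesis by simp
next
  case t: False
  have xv: "x # v \<in> lists X2" using assms by simp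
  have g: "f2 x \<in> carrier G2" using assms by simp
  have l: "C.pos (x # u @ v) t = (A.pos u (t - 1), f2 x \<otimes>\<^bsub>G2\<^esub> B.pos v (t - 1 - length u))"
    using t assms by (simp add: C.pos_Cons pos_concat gens2)
  have r: "C.pos (u @ x # v) t = (A.pos u t, B.pos (x # v) (t - length u))"
    using pos_concat[OF assms(1) xv] .
  have "C.cdist (C.pos (x # u @ v) t) (C.pos (u @ x # v) t)
      \<le> A.cdist (A.pos u (t - 1)) (A.pos u t)
        + B.cdist (f2 x \<otimes>\<^bsub>G2\<^esub> B.pos v (t - 1 - length u)) (B.pos (x # v) (t - length u))"
    unfolding l r by (rule cdist_product_le) (use assms xv g in auto)
  moreover have "A.cdist (A.pos u (t - 1)) (A.pos u t) \<le> 2"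
    using A.pos_lipschitz[OF assms(1), of "t - 1" t] by simp
  moreover have "B.cdist (f2 x \<otimes>\<^bsub>G2\<^esub> B.pos v (t - 1 - length u)) (B.pos (x # v) (t - length u)) \<le> 1"
  proof (cases "t - length u < 1")
    case True
    then show ?thesis
      using B.cdist_gen[of "\<one>\<^bsub>G2\<^esub>" x] B.cdist_sym[of "\<one>\<^bsub>G2\<^esub>" "f2 x"] assms by simp
  next
    case False
    have shift: "t - 1 - real (length u) = t - real (length u) - 1" by simp
    show ?thesis unfolding shift using False assms g by (simp add: B.pos_Cons)
  qed
  ultimately show ?thesis by linarith
qed

context
  fixes u u' v v' :: "'c list" and S :: "real set" and K :: real
  assumes u: "u \<in> lists X1" "u' \<in> lists X1" and v: "v \<in> lists X2" "v' \<in> lists X2"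
    and S: "slope_class S" and K: "0 \<le> K"
begin

abbreviation "near t s \<equiv> C.cdist (C.pos (u @ v) t) (C.pos (u' @ v') s) \<le> 2 * K + 2"

lemmas S_conv = slope_classD(1)[OF S] and S_pos = slope_classD(2)[OF S]

lemma nearI:
  assumes "A.cdist (A.pos u t) (A.pos u' s) \<le> K + 2"
    and "B.cdist (B.pos v (t - length u)) (B.pos v' (s - length u')) \<le> K"
  shows "near t s"
  using cdist_concat_le[OF u v, of t s] assms by linarith

lemma track_first_factor:
  assumes "track S (\<lambda>t s. A.cdist (A.pos u t) (A.pos u' s) \<le> K) a c b d"
    and "b \<le> length u" "d \<le> length u'"
  shows "track S near a c b d"
  using assms(1) order_refl S_pos
proof (rule track_mono)
  fix t s :: real assume "t \<le> b" "s \<le> d" "A.cdist (A.pos u t) (A.pos u' s) \<le> K"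
  then show "near t s" using assms(2,3) K by (intro nearI) auto
qed

lemma track_second_factor:
  assumes "track S (\<lambda>t s. B.cdist (B.pos v t) (B.pos v' s) \<le> K) a c (length v) (length v')"
    and "0 \<le> a" "0 \<le> c" and "A.cdist (A.val u) (A.val u') \<le> K"
  shows "track S near (a + length u) (c + length u') (length (u @ v)) (length (u' @ v'))"
proof -
  have "track S (\<lambda>t s. near (t + length u) (s + length u')) a c (length v) (length v')"
    using assms(1) order_refl S_pos
  proof (rule track_mono)
    fix t s :: real assume "a \<le> t" "c \<le> s" "B.cdist (B.pos v t) (B.pos v' s) \<le> K"
    then show "near (t + length u) (s + length u')" using assms(2-4) by (intro nearI) auto
  qed
  from track_shift[OF this] show ?thesis by (simp add: add.commute)
qed

lemma fellow_concat_same_emptiness: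
  assumes "u = [] \<longleftrightarrow> u' = []" "v = [] \<longleftrightarrow> v' = []"
    and "A.fellow S K u u'" "B.fellow S K v v'"
  shows "C.fellow S (2 * K + 2) (u @ v) (u' @ v')"
proof -
  have "track S (\<lambda>t s. A.cdist (A.pos u t) (A.pos u' s) \<le> K) 0 0 (length u) (length u')"
    using assms by (simp add: A.fellow_def)
  from track_first_factor[OF this] have 1: "track S near 0 0 (length u) (length u')" by simp
  have "track S (\<lambda>t s. B.cdist (B.pos v t) (B.pos v' s) \<le> K) 0 0 (length v) (length v')"
    using assms by (simp add: B.fellow_def)
  from track_second_factor[OF this] have 2:
    "track S near (length u) (length u') (length (u @ v)) (length (u' @ v'))"
    using A.fellow_ends(1)[OF assms(3)] by simp
  show ?thesis
    using track_join[OF S_conv 1 2] assms(1,2) by (auto simp: C.fellow_def)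
qed

text \<open>Here \<open>v\<close> is empty, so \<open>v'\<close> stays near the identity. It is traversed, together with the end of
  \<open>u'\<close>, while \<open>u\<close> runs through its last half edge. The mean slope on that half unit grows by \<open>2 l(v')\<close>.\<close>

lemma fellow_concat_into_second:
  assumes ne: "u \<noteq> []" "u' \<noteq> []" "v = []" "v' \<noteq> []"
    and fe: "A.fellow S K u u'" "B.fellow S K v v'"
    and S': "slope_class S'" "S \<subseteq> S'" and slope: "\<And>p. p \<in> S \<Longrightarrow> p + 2 * real (length v') \<in> S'"
  shows "C.fellow S' (2 * K + 2) (u @ v) (u' @ v')"
proof -
  let ?P = "\<lambda>t s. A.cdist (A.pos u t) (A.pos u' s) \<le> K"
  let ?n = "real (length u)" and ?m = "real (length u')" and ?k = "real (length v')"
  have n: "1 \<le> ?n" using ne by (cases u) auto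
  have S'pos: "S' \<subseteq> {0<..}" "convex S'" using S' by (auto simp: slope_class_def)
  have "track S ?P 0 0 ?n ?m" using fe(1) ne by (simp add: A.fellow_def)
  then obtain s0 where s0: "track S ?P 0 0 (?n - 1/2) s0" "track S ?P (?n - 1/2) s0 ?n ?m"
    by (rule track_split[of _ _ _ _ _ _ "?n - 1/2"]) (use n in auto)
  have p: "2 * (?m - s0) \<in> S" using track_slope[OF s0(2)] by (simp add: mult.commute)
  have "0 < s0" using track_slope[OF s0(1)] S_pos n by (auto simp: zero_less_divide_iff)
  moreover have le: "s0 \<le> ?m" using p S_pos by auto
  ultimately have "track S near 0 0 (?n - 1/2) s0" by (intro track_first_factor[OF s0(1)]) auto
  then have 1: "track S' near 0 0 (?n - 1/2) s0" by (rule track_mono) (use S'(2) S_pos in auto)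
  have 2: "track S' near (?n - 1/2) s0 ?n (?m + ?k)"
  proof (rule track_linear)
    show "(?m + ?k - s0) / (?n - (?n - 1/2)) \<in> S'" using slope[OF p] by (simp add: algebra_simps)
    fix t s assume t: "?n - 1/2 \<le> t" "t \<le> ?n" and s: "s0 \<le> s" "s \<le> ?m + ?k"
    have s': "A.pos u' s = A.pos u' (min s ?m)" by (simp add: min_def)
    obtain t' where t': "?n - 1/2 \<le> t'" "t' \<le> ?n" "?P t' (min s ?m)"
      by (rule track_onto[OF s0(2), of "min s ?m"]) (use s le in auto)
    have "\<bar>t - t'\<bar> \<le> 1" using t t' by linarith
    then have "A.cdist (A.pos u t) (A.pos u t') \<le> 2"
      using A.pos_lipschitz[OF u(1), of t t'] by linarith
    then have "A.cdist (A.pos u t) (A.pos u' s) \<le> K + 2"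
      using A.cdist_triangle[of "A.pos u t" "A.pos u t'" "A.pos u' s"] t'(3) s' u by simp
    moreover have "B.cdist (B.pos v (t - ?n)) (B.pos v' (s - ?m)) \<le> K"
      using fe(2) ne(3,4) unfolding B.fellow_def by auto
    ultimately show "near t s" by (rule nearI)
  qed (use S'pos in auto)
  show ?thesis
    using track_join[OF S'pos(2) 1 2] ne by (simp add: C.fellow_def)
qed

text \<open>Here \<open>u\<close> is empty, so \<open>u'\<close> stays near the identity. It is traversed, together with the beginning of
  \<open>v'\<close>, while \<open>v\<close> runs through its first half edge. The mean slope on that half unit grows by \<open>2 l(u')\<close>.\<close>

lemma fellow_concat_out_of_first:
  assumes ne: "u = []" "u' \<noteq> []" "v \<noteq> []" "v' \<noteq> []"
    and fe: "A.fellow S K u u'" "B.fellow S K v v'"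
    and S': "slope_class S'" "S \<subseteq> S'" and slope: "\<And>p. p \<in> S \<Longrightarrow> p + 2 * real (length u') \<in> S'"
  shows "C.fellow S' (2 * K + 2) (u @ v) (u' @ v')"
proof -
  let ?P = "\<lambda>t s. B.cdist (B.pos v t) (B.pos v' s) \<le> K"
  let ?n = "real (length v)" and ?m = "real (length v')" and ?k = "real (length u')"
  have n: "1 \<le> ?n" using ne by (cases v) auto
  have S'pos: "S' \<subseteq> {0<..}" "convex S'" using S' by (auto simp: slope_class_def)
  have "track S ?P 0 0 ?n ?m" using fe(2) ne by (simp add: B.fellow_def)
  then obtain s0 where s0: "track S ?P 0 0 (1/2) s0" "track S ?P (1/2) s0 ?n ?m"
    by (rule track_split[of _ _ _ _ _ _ "1/2"]) (use n in auto)
  have p: "2 * s0 \<in> S" using track_slope[OF s0(1)] by (simp add: mult.commute)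
  then have "0 < s0" using S_pos by auto
  then have "track S near (1/2) (?k + s0) (length (u @ v)) (length (u' @ v'))"
    using track_second_factor[OF s0(2)] A.fellow_ends(1)[OF fe(1)] ne(1) by (simp add: add.commute)
  then have 2: "track S' near (1/2) (?k + s0) (length (u @ v)) (length (u' @ v'))"
    by (rule track_mono) (use S'(2) S_pos in auto)
  have 1: "track S' near 0 0 (1/2) (?k + s0)"
  proof (rule track_linear)
    show "(?k + s0 - 0) / (1/2 - 0) \<in> S'" using slope[OF p] by (simp add: algebra_simps)
    fix t s :: real assume t: "0 \<le> t" "t \<le> 1/2" and s: "0 \<le> s" "s \<le> ?k + s0"
    have s': "B.pos v' (s - ?k) = B.pos v' (max 0 (s - ?k))" by (simp add: max_def)
    obtain t' where t': "0 \<le> t'" "t' \<le> 1/2" "?P t' (max 0 (s - ?k))"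
      by (rule track_onto[OF s0(1), of "max 0 (s - ?k)"]) (use s \<open>0 < s0\<close> in auto)
    then have "B.cdist (B.pos v (t - length u)) (B.pos v' (s - ?k)) \<le> K"
      unfolding s' using t ne(1) by simp
    moreover have "A.cdist (A.pos u t) (A.pos u' s) \<le> K"
      using fe(1) ne(1,2) unfolding A.fellow_def by auto
    ultimately show "near t s" by (intro nearI) auto
  qed (use S'pos in auto)
  show ?thesis
    using track_join[OF S'pos(2) 1 2] ne by (simp add: C.fellow_def)
qed

text \<open>Both concatenations stay near the identity, so any reparametrization will do.\<close>

lemma fellow_concat_crossed:
  assumes ne: "u = []" "u' \<noteq> []" "v \<noteq> []" "v' = []"
    and fe: "A.fellow S K u u'" "B.fellow S K v v'"
    and S': "slope_class S'" and slope: "real (length u') / real (length v) \<in> S'"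
  shows "C.fellow S' (2 * K + 2) (u @ v) (u' @ v')"
proof -
  have "track S' near 0 0 (length v) (length u')"
  proof (rule track_linear)
    fix t s :: real
    have "A.cdist (A.pos u t) (A.pos u' s) \<le> K"
      using fe(1) ne(1,2) unfolding A.fellow_def by auto
    moreover have "B.cdist (B.pos v (t - length u)) (B.pos v' (s - length u')) \<le> K"
      using fe(2) ne(3,4) unfolding B.fellow_def by auto
    ultimately show "near t s" by (intro nearI) auto
  qed (use ne slope S' in \<open>auto simp: slope_class_def\<close>)
  then show ?thesis using ne by (simp add: C.fellow_def)
qed

lemma fellow_concat_empty:
  assumes ne: "u = []" "v = []" "u' \<noteq> [] \<or> v' \<noteq> []"
    and fe: "A.fellow S K u u'" "B.fellow S K v v'"
  shows "C.fellow S' (2 * K + 2) (u @ v) (u' @ v')"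
proof -
  have "near t t" for t
  proof (rule nearI)
    show "A.cdist (A.pos u t) (A.pos u' t) \<le> K + 2"
      using fe(1) ne(1) K unfolding A.fellow_def by (cases "u' = []") (auto intro: order_trans)
    show "B.cdist (B.pos v (t - length u)) (B.pos v' (t - length u')) \<le> K"
      using fe(2) ne(2) K unfolding B.fellow_def by (cases "v' = []") auto
  qed
  then show ?thesis using ne by (auto simp: C.fellow_def)
qed

end

text \<open>The set \<open>N\<close> contains the possible lengths of words that are matched with the empty word. It consists
  of all numbers in the unbounded case and is an initial segment in the bounded case, where the slopes
  that arise from lengths in \<open>N\<close> lead from \<open>S\<close> to the larger class \<open>S'\<close>. Symmetry of fellow
  travelling halves the number of cases.\<close>

lemma fellow_concat:
  assumes words: "u \<in> lists X1" "u' \<in> lists X1" "v \<in> lists X2" "v' \<in> lists X2"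
    and S: "slope_class S" "slope_class S'" "S \<subseteq> S'"
    and fe: "A.fellow S K u u'" "B.fellow S K v v'"
    and N1: "(u = []) \<noteq> (u' = []) \<Longrightarrow> length u + length u' \<in> N"
    and N2: "(v = []) \<noteq> (v' = []) \<Longrightarrow> length v + length v' \<in> N"
    and add: "\<And>p j. p \<in> S \<Longrightarrow> j \<in> N \<Longrightarrow> p + 2 * real j \<in> S'"
    and div: "\<And>i j. i \<in> N \<Longrightarrow> j \<in> N \<Longrightarrow> 0 < i \<Longrightarrow> 0 < j \<Longrightarrow> real j / real i \<in> S'"
  shows "C.fellow S' (2 * K + 2) (u @ v) (u' @ v')"
proof -
  have K: "0 \<le> K" using A.fellow_ends(2)[OF fe(1)] .
  have *: "C.fellow S' (2 * K + 2) (u @ v) (u' @ v')"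
    if words: "u \<in> lists X1" "u' \<in> lists X1" "v \<in> lists X2" "v' \<in> lists X2"
    and fe: "A.fellow S K u u'" "B.fellow S K v v'"
    and N1: "(u = []) \<noteq> (u' = []) \<Longrightarrow> length u + length u' \<in> N"
    and N2: "(v = []) \<noteq> (v' = []) \<Longrightarrow> length v + length v' \<in> N"
    and d: "u = [] \<and> u' \<noteq> [] \<or> (u = [] \<longleftrightarrow> u' = []) \<and> v = [] \<and> v' \<noteq> []" for u u' v v'
  proof -
    consider "u = []" "v = []" "u' \<noteq> [] \<or> v' \<noteq> []"
      | "u = []" "u' \<noteq> []" "v \<noteq> []" "v' \<noteq> []"
      | "u = []" "u' \<noteq> []" "v \<noteq> []" "v' = []"
      | "u \<noteq> []" "u' \<noteq> []" "v = []" "v' \<noteq> []" using d by blast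
    then show ?thesis
    proof cases
      case 1
      then show ?thesis by (rule fellow_concat_empty[OF words S(1) K _ _ _ fe])
    next
      case 2
      have "length u' \<in> N" using N1 2 by simp
      then show ?thesis
        using fellow_concat_out_of_first[OF words S(1) K 2 fe S(2,3)] add by blast
    next
      case 3
      have "length u' \<in> N" "length v \<in> N" using N1 N2 3 by simp_all
      then have "real (length u') / real (length v) \<in> S'" using div 3 by simp
      then show ?thesis by (rule fellow_concat_crossed[OF words S(1) K 3 fe S(2)])
    next
      case 4
      have "length v' \<in> N" using N2 4 by simp
      then show ?thesis
        using fellow_concat_into_second[OF words S(1) K 4 fe S(2,3)] add by blast
    qed
  qed
  consider (same) "u = [] \<longleftrightarrow> u' = []" "v = [] \<longleftrightarrow> v' = []"
    | (forward) "u = [] \<and> u' \<noteq> [] \<or> (u = [] \<longleftrightarrow> u' = []) \<and> v = [] \<and> v' \<noteq> []"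
    | (backward) "u' = [] \<and> u \<noteq> [] \<or> (u' = [] \<longleftrightarrow> u = []) \<and> v' = [] \<and> v \<noteq> []"
    by blast
  then show ?thesis
  proof cases
    case same
    have fe': "A.fellow S' K u u'" "B.fellow S' K v v'"
      using fe same S unfolding A.fellow_def B.fellow_def slope_class_def
      by (auto intro: track_mono)
    show ?thesis by (rule fellow_concat_same_emptiness[OF words S(2) K same fe'])
  next
    case forward
    show ?thesis by (rule *[OF words fe N1 N2 forward])
  next
    case backward
    have "C.fellow S' (2 * K + 2) (u' @ v') (u @ v)"
    proof (rule *)
      show "A.fellow S K u' u" by (rule A.fellow_sym[OF S(1) words(1,2) fe(1)])
      show "B.fellow S K v' v" by (rule B.fellow_sym[OF S(1) words(3,4) fe(2)])
      show "length u' + length u \<in> N" if "(u' = []) \<noteq> (u = [])" using N1 that by (simp add: add.commute)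
      show "length v' + length v \<in> N" if "(v' = []) \<noteq> (v = [])" using N2 that by (simp add: add.commute)
    qed (use words backward in auto)
    then show ?thesis
      by (rule C.fellow_sym[OF S(2), rotated -1]) (use words in auto)
  qed
qed

end

section \<open>Pairs of words in a combing\<close>

text \<open>Treating combings and bicombings by one definition lets each type of fellow travelling be handled
  once for both.\<close>

definition pairs :: "bool \<Rightarrow> ('a, 'm) monoid_scheme \<Rightarrow> 'c set \<Rightarrow> ('c \<Rightarrow> 'a) \<Rightarrow> 'c list set
    \<Rightarrow> ('c list \<times> 'c list) set" where
  "pairs two_sided G X f L = (if two_sided then bicombing_pairs G X f L else combing_pairs G X f L)"

lemma combing_pairs_subset: "combing_pairs G X f L \<subseteq> pairs b G X f L"
  and pairs_subset: "pairs b G X f L \<subseteq> bicombing_pairs G X f L"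
  by (auto simp: pairs_def bicombing_pairs_def)

context marked_group
begin

lemma combing_pairs_iff:
  assumes "L \<subseteq> lists X"
  shows "(v, w) \<in> combing_pairs G X f L \<longleftrightarrow> v \<in> L \<and> w \<in> L
    \<and> (val w = val v \<or> (\<exists>x\<in>X. val w = val v \<otimes> f x))"
  using assms val_append[of v "[_]"] unfolding combing_pairs_def by fastforce

lemma bicombing_pairs_lists:
  assumes "L \<subseteq> lists X" "(v, w) \<in> bicombing_pairs G X f L"
  shows "v \<in> lists X" "w \<in> lists X"
proof -
  have "v \<in> L \<or> (\<exists>x v0. v = x # v0 \<and> x \<in> X \<and> v0 \<in> L)" "w \<in> L"
    using assms(2) by (auto simp: bicombing_pairs_def combing_pairs_def)
  moreover have "v0 \<in> lists X" if "v0 \<in> L" for v0 using that assms(1) by blast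
  ultimately show "v \<in> lists X" "w \<in> lists X" by (metis lists.Cons)+
qed

text \<open>Up to one letter at the start of \<open>v\<close>, a pair consists of words of the language whose values are equal or differ
  by one generator. As the generators are closed under inverses, this relation of values is
  symmetric.\<close>

lemma bicombing_pairs_neighbours:
  assumes "L \<subseteq> lists X" "(v, w) \<in> bicombing_pairs G X f L"
  obtains v0 where "v0 \<in> L" "w \<in> L" "length v0 \<le> length v" "length v \<le> length v0 + 1"
    and "val w = val v0 \<or> (\<exists>x\<in>X. val w = val v0 \<otimes> f x) \<or> (\<exists>x\<in>X. val w = f x \<otimes> val v0)"
    and "val v0 = val w \<or> (\<exists>x\<in>X. val v0 = val w \<otimes> f x) \<or> (\<exists>x\<in>X. val v0 = f x \<otimes> val w)"
proof -
  consider "v \<in> L" "w \<in> L" "val w = val v"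
    | x where "v \<in> L" "w \<in> L" "x \<in> X" "val w = val v \<otimes> f x"
    | x v0 where "v = x # v0" "v0 \<in> L" "w \<in> L" "x \<in> X" "val w = f x \<otimes> val v0"
    using assms combing_pairs_iff[OF assms(1)] unfolding bicombing_pairs_def by auto
  then show ?thesis
  proof cases
    case 1
    then show ?thesis by (intro that[of v]) auto
  next
    case 2
    obtain y where y: "y \<in> X" "f y = inv (f x)" using gen_inv[OF 2(3)] by blast
    have "v \<in> lists X" using 2 assms by blast
    then have "val v = val w \<otimes> f y" using 2 y by (simp add: m_assoc)
    then have *: "\<exists>x\<in>X. val v = val w \<otimes> f x" using y(1) by blast
    show ?thesis by (rule that[of v]) (use 2 * in \<open>blast | simp\<close>)+
  next
    case 3
    obtain y where y: "y \<in> X" "f y = inv (f x)" using gen_inv[OF 3(4)] by blast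
    have "v0 \<in> lists X" using 3 assms by blast
    then have "val v0 = f y \<otimes> val w" using 3 y by (simp add: m_assoc[symmetric])
    then have *: "\<exists>x\<in>X. val v0 = f x \<otimes> val w" using y(1) by blast
    show ?thesis by (rule that[of v0]) (use 3 * in \<open>blast | simp\<close>)+
  qed
qed

lemma fellow_mono:
  assumes "fellow S K v w" "K \<le> K'" "S \<subseteq> S'" "S \<subseteq> {0<..}"
  shows "fellow S' K' v w"
proof (cases "v = [] \<longleftrightarrow> w = []")
  case True
  then have "track S (\<lambda>t s. cdist (pos v t) (pos w s) \<le> K) 0 0 (length v) (length w)"
    using assms(1) unfolding fellow_def by simp
  then have "track S' (\<lambda>t s. cdist (pos v t) (pos w s) \<le> K') 0 0 (length v) (length w)"
    by (rule track_mono[OF _ assms(3,4)]) (use assms(2) in linarith)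
  then show ?thesis using True unfolding fellow_def by simp
next
  case False
  then have "cdist (pos v t) (pos w t) \<le> K" for t using assms(1) unfolding fellow_def by meson
  then have "cdist (pos v t) (pos w t) \<le> K'" for t using assms(2) order_trans by blast
  then show ?thesis using False unfolding fellow_def by auto
qed

text \<open>Two non-empty words with the same value are matched by a reparametrization with slopes
  at most \<open>M\<close>, so one of them bounds the length of all the others. There are only finitely
  many values near the identity.\<close>

lemma bounded_length_near_identity:
  assumes L: "L \<subseteq> lists X" and M: "1 \<le> M"
    and fe: "\<And>v w. (v, w) \<in> combing_pairs G X f L \<Longrightarrow> fellow {1/M..M} K v w"
  obtains C :: nat where "\<And>w. w \<in> L \<Longrightarrow> val w \<in> insert \<one> (f ` X) \<Longrightarrow> length w \<le> C"
proof -
  have "\<exists>c. \<forall>w\<in>L. val w = g \<longrightarrow> length w \<le> c" for g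
  proof (cases "\<exists>w\<in>L. val w = g \<and> w \<noteq> []")
    case True
    then obtain w0 where w0: "w0 \<in> L" "val w0 = g" "w0 \<noteq> []" by blast
    have "length w \<le> nat \<lceil>M * length w0\<rceil>" if w: "w \<in> L" "val w = g" for w
    proof (cases "w = []")
      case False
      have "(w0, w) \<in> combing_pairs G X f L" using w w0 combing_pairs_iff[OF L] by simp
      from fe[OF this]
      have "track {1/M..M} (\<lambda>t s. cdist (pos w0 t) (pos w s) \<le> K) 0 0 (length w0) (length w)"
        using False w0 unfolding fellow_def by simp
      from track_slope[OF this] have "real (length w) / real (length w0) \<le> M" using w0 by simp
      then have "real (length w) \<le> M * length w0" using w0 by (simp add: field_simps)
      then show ?thesis by linarith
    qed simp
    then show ?thesis by blast
  next
    case False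
    then have "\<forall>w\<in>L. val w = g \<longrightarrow> length w \<le> 0" by auto
    then show ?thesis by blast
  qed
  then obtain c where c: "\<And>g w. w \<in> L \<Longrightarrow> val w = g \<Longrightarrow> length w \<le> c g" by metis
  have "finite (insert \<one> (f ` X))" using gens by (simp add: generating_set_def)
  then have "length w \<le> Max (c ` insert \<one> (f ` X))" if "w \<in> L" "val w \<in> insert \<one> (f ` X)" for w
    using that c[OF that(1) refl] by (meson Max_ge finite_imageI imageI order_trans)
  then show ?thesis by (rule that)
qed

lemma bounded_length_against_empty:
  assumes L: "L \<subseteq> lists X" and M: "1 \<le> M"
    and fe: "\<And>v w. (v, w) \<in> combing_pairs G X f L \<Longrightarrow> fellow {1/M..M} K v w"
  obtains C where "\<forall>(v, w)\<in>bicombing_pairs G X f L. (v = []) \<noteq> (w = []) \<longrightarrow> length v + length w \<le> C"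
proof -
  obtain C :: nat where C: "\<And>w. w \<in> L \<Longrightarrow> val w \<in> insert \<one> (f ` X) \<Longrightarrow> length w \<le> C"
    using bounded_length_near_identity[OF L M fe] by blast
  have "length v + length w \<le> C + 1"
    if vw: "(v, w) \<in> bicombing_pairs G X f L" "(v = []) \<noteq> (w = [])" for v w
  proof -
    obtain v0 where v0: "v0 \<in> L" "w \<in> L" "length v0 \<le> length v" "length v \<le> length v0 + 1"
      and 1: "val w = val v0 \<or> (\<exists>x\<in>X. val w = val v0 \<otimes> f x) \<or> (\<exists>x\<in>X. val w = f x \<otimes> val v0)"
      and 2: "val v0 = val w \<or> (\<exists>x\<in>X. val v0 = val w \<otimes> f x) \<or> (\<exists>x\<in>X. val v0 = f x \<otimes> val w)"
      by (rule bicombing_pairs_neighbours[OF L vw(1)])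
    show ?thesis
    proof (cases "v = []")
      case True
      then have "v0 = []" using v0 by simp
      then have "length w \<le> C" using 1 by (intro C[OF v0(2)]) auto
      then show ?thesis using True by simp
    next
      case False
      then have w: "w = []" using vw(2) by simp
      then have "length v0 \<le> C" using 2 by (intro C[OF v0(1)]) auto
      then show ?thesis using w v0 by simp
    qed
  qed
  then show ?thesis by (intro that[of "C + 1"]) auto
qed

lemma geodesic_length_le:
  assumes "v \<in> lists X" "val v = val w" shows "geodesic_length G X f w \<le> length v"
  unfolding geodesic_length_def by (rule Least_le) (use assms in blast)

lemma geodesic_word:
  assumes "w \<in> lists X"
  obtains v where "v \<in> lists X" "val v = val w" "length v = geodesic_length G X f w"
proof -
  have "\<exists>v\<in>lists X. val v = val w \<and> length v = geodesic_length G X f w"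
    unfolding geodesic_length_def by (rule LeastI[of _ "length w"]) (use assms in blast)
  then show ?thesis using that by blast
qed

text \<open>A geodesic word for \<open>v\<close>, extended by at most one letter, represents \<open>w\<close>.\<close>

lemma geodesic_length_neighbour:
  assumes "v \<in> lists X"
    and "val w = val v \<or> (\<exists>x\<in>X. val w = val v \<otimes> f x) \<or> (\<exists>x\<in>X. val w = f x \<otimes> val v)"
  shows "geodesic_length G X f w \<le> geodesic_length G X f v + 1"
proof -
  obtain u where u: "u \<in> lists X" "val u = val v" "length u = geodesic_length G X f v"
    by (rule geodesic_word[OF assms(1)])
  consider "val w = val v" | x where "x \<in> X" "val w = val v \<otimes> f x"
    | x where "x \<in> X" "val w = f x \<otimes> val v" using assms(2) by blast
  then show ?thesis
  proof cases
    case 1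
    then show ?thesis using geodesic_length_le[of u w] u by simp
  next
    case 2
    then show ?thesis using geodesic_length_le[of "u @ [x]" w] u by (simp add: val_append)
  next
    case 3
    then show ?thesis using geodesic_length_le[of "x # u" w] u by simp
  qed
qed

lemma near_geodesic_length_diff:
  assumes ng: "near_geodesic G X f L"
  obtains C where "\<And>v w. (v, w) \<in> bicombing_pairs G X f L \<Longrightarrow>
    \<bar>real (length v) - real (length w)\<bar> \<le> C"
proof -
  have L: "L \<subseteq> lists X" using ng by (simp add: near_geodesic_def language_for_def)
  obtain e where e: "\<And>w. w \<in> L \<Longrightarrow> real (length w) - real (geodesic_length G X f w) < e"
    using ng unfolding near_geodesic_def by blast
  have "\<bar>real (length v) - real (length w)\<bar> \<le> \<bar>e\<bar> + 2" if vw: "(v, w) \<in> bicombing_pairs G X f L" for v w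
  proof -
    obtain v0 where v0: "v0 \<in> L" "w \<in> L" "length v0 \<le> length v" "length v \<le> length v0 + 1"
      and 1: "val w = val v0 \<or> (\<exists>x\<in>X. val w = val v0 \<otimes> f x) \<or> (\<exists>x\<in>X. val w = f x \<otimes> val v0)"
      and 2: "val v0 = val w \<or> (\<exists>x\<in>X. val v0 = val w \<otimes> f x) \<or> (\<exists>x\<in>X. val v0 = f x \<otimes> val w)"
      by (rule bicombing_pairs_neighbours[OF L vw])
    have X: "v0 \<in> lists X" "w \<in> lists X" using v0 L by auto
    show ?thesis
      using e[OF v0(1)] e[OF v0(2)] geodesic_length_neighbour[OF X(1) 1]
        geodesic_length_neighbour[OF X(2) 2] geodesic_length_le[OF X(1) refl]
        geodesic_length_le[OF X(2) refl] v0(3,4)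
      by linarith
  qed
  then show ?thesis by (rule that)
qed

lemma combing_imp_async_combing:
  assumes "combing G X f L" shows "async_combing G X f L"
proof -
  have L: "language_for G X f L"
    using assms unfolding combing_def sync_combing_def bounded_async_combing_def async_combing_def
      sync_bicombing_def bounded_async_bicombing_def async_bicombing_def by blast
  then have X: "v \<in> lists X" "w \<in> lists X" if "(v, w) \<in> combing_pairs G X f L" for v w
    using that by (auto simp: language_for_def combing_pairs_def)
  have sub: "combing_pairs G X f L \<subseteq> bicombing_pairs G X f L" by (simp add: bicombing_pairs_def)
  have bounded: "async_fellow_travel G X f K v w" if "bounded_async_fellow_travel G X f K M v w" for K M v w
    using that unfolding async_fellow_travel_def bounded_async_fellow_travel_def by blast
  consider (sync) K where "\<forall>(v, w)\<in>combing_pairs G X f L. sync_fellow_travel G X f K v w"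
    | (async) K where "\<forall>(v, w)\<in>combing_pairs G X f L. async_fellow_travel G X f K v w"
    using assms sub bounded
    unfolding combing_def sync_combing_def bounded_async_combing_def async_combing_def
      sync_bicombing_def bounded_async_bicombing_def async_bicombing_def by blast
  then show ?thesis
  proof cases
    case sync
    have "async_fellow_travel G X f (K + 2 + 2 + 4) v w" if p: "(v, w) \<in> combing_pairs G X f L" for v w
    proof (rule fellow_imp_async[OF X[OF p] near_imp_fellow[OF X[OF p]]])
      show "cdist (pos v t) (pos w t) \<le> K + 2" for t
        using sync_imp_near[OF X[OF p]] sync p by blast
    qed
    then show ?thesis using L unfolding async_combing_def by blast
  next
    case async
    then show ?thesis using L unfolding async_combing_def by blast
  qed
qed

end

context marked_product
begin

abbreviation "prodG \<equiv> G1 \<times>\<times> G2"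
abbreviation "prodX \<equiv> X1 \<union> X2"
abbreviation "prodf \<equiv> product_gens G1 G2 X1 f1 f2"

lemma language_for_concat:
  assumes "language_for G1 X1 f1 L1" "language_for G2 X2 f2 L2"
  shows "language_for prodG prodX prodf (lang_concat L1 L2)"
proof -
  have L: "L1 \<subseteq> lists X1" "L2 \<subseteq> lists X2" using assms by (simp_all add: language_for_def)
  have "\<exists>w\<in>lang_concat L1 L2. C.val w = p" if "p \<in> carrier prodG" for p
  proof -
    obtain g h where p: "p = (g, h)" by (cases p)
    then have "g \<in> carrier G1" "h \<in> carrier G2" using that by simp_all
    then obtain u v where "u \<in> L1" "A.val u = g" "v \<in> L2" "B.val v = h"
      using assms unfolding language_for_def by blast
    moreover from this have "C.val (u @ v) = (g, h)" using L val_concat[of u v] by blast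
    ultimately show ?thesis unfolding lang_concat_def using p by blast
  qed
  moreover have "lang_concat L1 L2 \<subseteq> lists prodX" using L by (force simp: lang_concat_def)
  ultimately show ?thesis by (simp add: language_for_def)
qed

lemma bijective_language_concat:
  assumes "bijective_language G1 X1 f1 L1" "bijective_language G2 X2 f2 L2"
  shows "bijective_language prodG prodX prodf (lang_concat L1 L2)"
proof -
  have lf: "language_for G1 X1 f1 L1" "language_for G2 X2 f2 L2"
    using assms by (simp_all add: bijective_language_def)
  then have L: "L1 \<subseteq> lists X1" "L2 \<subseteq> lists X2" by (simp_all add: language_for_def)
  have lang: "language_for prodG prodX prodf (lang_concat L1 L2)" by (rule language_for_concat[OF lf])
  have uniq1: "u = u'" if "u \<in> L1" "u' \<in> L1" "A.val u = A.val u'" for u u'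
  proof -
    have "A.val u \<in> carrier G1" using that L by (intro A.val_closed) blast
    then have "\<exists>!w. w \<in> L1 \<and> A.val w = A.val u" using assms(1) by (simp add: bijective_language_def)
    then show ?thesis using that by metis
  qed
  have uniq2: "v = v'" if "v \<in> L2" "v' \<in> L2" "B.val v = B.val v'" for v v'
  proof -
    have "B.val v \<in> carrier G2" using that L by (intro B.val_closed) blast
    then have "\<exists>!w. w \<in> L2 \<and> B.val w = B.val v" using assms(2) by (simp add: bijective_language_def)
    then show ?thesis using that by metis
  qed
  have "w = w'" if w: "w \<in> lang_concat L1 L2" "w' \<in> lang_concat L1 L2" "C.val w = C.val w'" for w w'
  proof -
    obtain u v u' v' where uv: "w = u @ v" "w' = u' @ v'" "u \<in> L1" "u' \<in> L1" "v \<in> L2" "v' \<in> L2"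
      using w unfolding lang_concat_def by blast
    have X: "u \<in> lists X1" "v \<in> lists X2" "u' \<in> lists X1" "v' \<in> lists X2" using uv L by blast+
    have "(A.val u, B.val v) = (A.val u', B.val v')"
      using w(3) val_concat[OF X(1,2)] val_concat[OF X(3,4)] uv by simp
    then show ?thesis using uniq1[OF uv(3,4)] uniq2[OF uv(5,6)] uv(1,2) by simp
  qed
  moreover have "\<exists>w. w \<in> lang_concat L1 L2 \<and> C.val w = g" if "g \<in> carrier prodG" for g
    using lang that unfolding language_for_def by blast
  ultimately have "\<exists>!w. w \<in> lang_concat L1 L2 \<and> C.val w = g" if "g \<in> carrier prodG" for g
    using that by (intro ex_ex1I) blast+
  then show ?thesis using lang unfolding bijective_language_def by blast
qed

text \<open>A generator of the product is a generator of one factor and trivial in the other, so the pair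
  in the other factor has equal values, which also makes it a pair of a combing.\<close>

lemma combing_pairs_concat:
  assumes L: "L1 \<subseteq> lists X1" "L2 \<subseteq> lists X2"
    and pq: "(p, q) \<in> combing_pairs prodG prodX prodf (lang_concat L1 L2)"
  obtains u u' v v' where "p = u @ v" "q = u' @ v'"
    "(u, u') \<in> combing_pairs G1 X1 f1 L1" "(v, v') \<in> combing_pairs G2 X2 f2 L2"
proof -
  have LL: "lang_concat L1 L2 \<subseteq> lists prodX" using L by (force simp: lang_concat_def)
  have pq': "p \<in> lang_concat L1 L2" "q \<in> lang_concat L1 L2"
    "C.val q = C.val p \<or> (\<exists>x\<in>prodX. C.val q = C.val p \<otimes>\<^bsub>prodG\<^esub> prodf x)"
    using pq C.combing_pairs_iff[OF LL] by blast+
  then obtain u v u' v' where uv: "p = u @ v" "q = u' @ v'" "u \<in> L1" "u' \<in> L1" "v \<in> L2" "v' \<in> L2"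
    unfolding lang_concat_def by blast
  have X: "u \<in> lists X1" "v \<in> lists X2" "u' \<in> lists X1" "v' \<in> lists X2" using uv L by blast+
  have val: "C.val p = (A.val u, B.val v)" "C.val q = (A.val u', B.val v')"
    using val_concat[OF X(1,2)] val_concat[OF X(3,4)] uv by simp_all
  consider "A.val u' = A.val u" "B.val v' = B.val v"
    | x where "x \<in> X1" "A.val u' = A.val u \<otimes>\<^bsub>G1\<^esub> f1 x" "B.val v' = B.val v"
    | x where "x \<in> X2" "A.val u' = A.val u" "B.val v' = B.val v \<otimes>\<^bsub>G2\<^esub> f2 x"
  proof -
    have 1: "C.val p \<otimes>\<^bsub>prodG\<^esub> prodf x = (A.val u \<otimes>\<^bsub>G1\<^esub> f1 x, B.val v)" if "x \<in> X1" for x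
      using that X val by (simp add: gens1)
    have 2: "C.val p \<otimes>\<^bsub>prodG\<^esub> prodf x = (A.val u, B.val v \<otimes>\<^bsub>G2\<^esub> f2 x)" if "x \<in> X2" for x
      using that X val by (simp add: gens2)
    show ?thesis using pq'(3) 1 2 val that by (metis Pair_inject Un_iff)
  qed
  then have "(u, u') \<in> combing_pairs G1 X1 f1 L1 \<and> (v, v') \<in> combing_pairs G2 X2 f2 L2"
    unfolding A.combing_pairs_iff[OF L(1)] B.combing_pairs_iff[OF L(2)] using uv by cases auto
  then show ?thesis using uv that by blast
qed

text \<open>Multiplication on the left by a letter of \<open>X1\<close> changes only the first factor. For a letter of
  \<open>X2\<close> it is \<open>x v\<close> that belongs to a pair, although in the word \<open>x u v\<close> the letter \<open>x\<close> stands in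
  front of \<open>u\<close>.\<close>

lemma left_pairs_concat:
  assumes L: "L1 \<subseteq> lists X1" "L2 \<subseteq> lists X2"
    and x: "x \<in> prodX" and w: "w \<in> lang_concat L1 L2" "q \<in> lang_concat L1 L2"
    and eq: "C.val q = C.val (x # w)"
  obtains (first) u u' v v' where "x # w = u @ v" "q = u' @ v'"
      "(u, u') \<in> bicombing_pairs G1 X1 f1 L1" "(v, v') \<in> combing_pairs G2 X2 f2 L2"
    | (second) u u' v v' where "x \<in> X2" "x # w = x # u @ v" "q = u' @ v'"
      "(u, u') \<in> combing_pairs G1 X1 f1 L1" "(x # v, v') \<in> bicombing_pairs G2 X2 f2 L2"
proof -
  obtain u v u' v' where uv: "w = u @ v" "q = u' @ v'" "u \<in> L1" "u' \<in> L1" "v \<in> L2" "v' \<in> L2"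
    using w unfolding lang_concat_def by blast
  have X: "u \<in> lists X1" "v \<in> lists X2" "u' \<in> lists X1" "v' \<in> lists X2" using uv L by blast+
  have val: "C.val w = (A.val u, B.val v)" "C.val q = (A.val u', B.val v')"
    using val_concat[OF X(1,2)] val_concat[OF X(3,4)] uv by simp_all
  show ?thesis
  proof (cases "x \<in> X1")
    case True
    have "A.val u' = A.val (x # u)" "B.val v' = B.val v"
      using eq val True X by (simp_all add: gens1)
    then have "(x # u, u') \<in> bicombing_pairs G1 X1 f1 L1" "(v, v') \<in> combing_pairs G2 X2 f2 L2"
      using uv True by (auto simp: bicombing_pairs_def combing_pairs_def)
    then show ?thesis using first[of "x # u" v] uv by simp
  next
    case False
    then have x2: "x \<in> X2" using x by simp
    have "A.val u' = A.val u" "B.val v' = B.val (x # v)"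
      using eq val x2 X by (simp_all add: gens2)
    then have "(u, u') \<in> combing_pairs G1 X1 f1 L1" "(x # v, v') \<in> bicombing_pairs G2 X2 f2 L2"
      using uv x2 unfolding bicombing_pairs_def combing_pairs_def by blast+
    then show ?thesis using second[of u v] uv x2 by simp
  qed
qed

text \<open>To bound all pairs of the product language it is enough to treat concatenations of pairs of the
  two languages, for a relation \<open>R\<close>, and to move one letter past a word over \<open>X1\<close>, which may weaken \<open>R\<close> to
  \<open>R'\<close>.\<close>

lemma pairs_concat_induct:
  assumes L: "L1 \<subseteq> lists X1" "L2 \<subseteq> lists X2"
    and pq: "(p, q) \<in> pairs b prodG prodX prodf (lang_concat L1 L2)"
    and concat: "\<And>u u' v v'. (u, u') \<in> pairs b G1 X1 f1 L1 \<Longrightarrow> (v, v') \<in> pairs b G2 X2 f2 L2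
      \<Longrightarrow> R (u @ v) (u' @ v')"
    and R: "\<And>p q. R p q \<Longrightarrow> R' p q"
    and move: "\<And>u x v q. u \<in> lists X1 \<Longrightarrow> x \<in> X2 \<Longrightarrow> v \<in> lists X2 \<Longrightarrow> q \<in> lists prodX
      \<Longrightarrow> R (u @ x # v) q \<Longrightarrow> R' (x # u @ v) q"
  shows "R' p q"
proof -
  consider (right) "(p, q) \<in> combing_pairs prodG prodX prodf (lang_concat L1 L2)"
    | (left) x w where "b" "p = x # w" "x \<in> prodX" "w \<in> lang_concat L1 L2" "q \<in> lang_concat L1 L2"
        "C.val q = C.val (x # w)"
    using pq by (auto simp: pairs_def bicombing_pairs_def split: if_splits)
  then show ?thesis
  proof cases
    case right
    show ?thesis
    proof (rule combing_pairs_concat[OF L right])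
      fix u u' v v' assume *: "p = u @ v" "q = u' @ v'"
        "(u, u') \<in> combing_pairs G1 X1 f1 L1" "(v, v') \<in> combing_pairs G2 X2 f2 L2"
      show ?thesis
        using R[OF concat] subsetD[OF combing_pairs_subset *(3)] subsetD[OF combing_pairs_subset *(4)]
        unfolding *(1,2) .
    qed
  next
    case left
    have b: "pairs b G1 X1 f1 L1 = bicombing_pairs G1 X1 f1 L1"
      "pairs b G2 X2 f2 L2 = bicombing_pairs G2 X2 f2 L2"
      using left(1) by (simp_all add: pairs_def)
    have "q \<in> lists prodX" using left(5) L by (force simp: lang_concat_def)
    show ?thesis
    proof (rule left_pairs_concat[OF L left(3-6)])
      fix u u' v v' assume "x # w = u @ v" "q = u' @ v'"
        "(u, u') \<in> bicombing_pairs G1 X1 f1 L1" "(v, v') \<in> combing_pairs G2 X2 f2 L2"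
      then show ?thesis
        using R[OF concat[of u u' v v']] left(2) b
          subsetD[OF combing_pairs_subset, of "(v, v')" G2 X2 f2 L2 b] by simp
    next
      fix u u' v v' assume *: "x \<in> X2" "x # w = x # u @ v" "q = u' @ v'"
        "(u, u') \<in> combing_pairs G1 X1 f1 L1" "(x # v, v') \<in> bicombing_pairs G2 X2 f2 L2"
      have "(u, u') \<in> pairs b G1 X1 f1 L1" by (rule subsetD[OF combing_pairs_subset *(4)])
      then have "R (u @ x # v) q" using concat[of u u' "x # v" v'] * b by simp
      moreover have "u \<in> lists X1" using *(4) L by (auto simp: combing_pairs_def)
      moreover have "v \<in> lists X2" using B.bicombing_pairs_lists(1)[OF L(2) *(5)] by simp
      ultimately show ?thesis using move[of u x v q] * left(2) \<open>q \<in> lists prodX\<close> by simp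
    qed
  qed
qed

end

section \<open>Combings of the direct product\<close>

context marked_product
begin

lemma pairs_lists:
  assumes "L1 \<subseteq> lists X1" "L2 \<subseteq> lists X2"
  shows "(u, u') \<in> pairs b G1 X1 f1 L1 \<Longrightarrow> u \<in> lists X1 \<and> u' \<in> lists X1"
    and "(v, v') \<in> pairs b G2 X2 f2 L2 \<Longrightarrow> v \<in> lists X2 \<and> v' \<in> lists X2"
    and "(p, q) \<in> pairs b prodG prodX prodf (lang_concat L1 L2) \<Longrightarrow> p \<in> lists prodX \<and> q \<in> lists prodX"
proof -
  have LL: "lang_concat L1 L2 \<subseteq> lists prodX" using assms by (force simp: lang_concat_def)
  show "(u, u') \<in> pairs b G1 X1 f1 L1 \<Longrightarrow> u \<in> lists X1 \<and> u' \<in> lists X1"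
    using A.bicombing_pairs_lists[OF assms(1)] pairs_subset by blast
  show "(v, v') \<in> pairs b G2 X2 f2 L2 \<Longrightarrow> v \<in> lists X2 \<and> v' \<in> lists X2"
    using B.bicombing_pairs_lists[OF assms(2)] pairs_subset by blast
  show "(p, q) \<in> pairs b prodG prodX prodf (lang_concat L1 L2) \<Longrightarrow> p \<in> lists prodX \<and> q \<in> lists prodX"
    using C.bicombing_pairs_lists[OF LL] pairs_subset by blast
qed

lemma fellow_pairs_concat:
  assumes L: "L1 \<subseteq> lists X1" "L2 \<subseteq> lists X2"
    and S: "slope_class S" "slope_class S'" "S \<subseteq> S'"
    and fe1: "\<And>u u'. (u, u') \<in> pairs b G1 X1 f1 L1 \<Longrightarrow> A.fellow S K u u'"
    and fe2: "\<And>v v'. (v, v') \<in> pairs b G2 X2 f2 L2 \<Longrightarrow> B.fellow S K v v'"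
    and N1: "\<And>u u'. (u, u') \<in> pairs b G1 X1 f1 L1 \<Longrightarrow> (u = []) \<noteq> (u' = []) \<Longrightarrow> length u + length u' \<in> N"
    and N2: "\<And>v v'. (v, v') \<in> pairs b G2 X2 f2 L2 \<Longrightarrow> (v = []) \<noteq> (v' = []) \<Longrightarrow> length v + length v' \<in> N"
    and add: "\<And>p j. p \<in> S \<Longrightarrow> j \<in> N \<Longrightarrow> p + 2 * real j \<in> S'"
    and div: "\<And>i j. i \<in> N \<Longrightarrow> j \<in> N \<Longrightarrow> 0 < i \<Longrightarrow> 0 < j \<Longrightarrow> real j / real i \<in> S'"
    and pq: "(p, q) \<in> pairs b prodG prodX prodf (lang_concat L1 L2)"
  shows "C.fellow S' (2 * K + 5) p q"
proof -
  have S'pos: "S' \<subseteq> {0<..}" using S(2) by (simp add: slope_class_def)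
  show ?thesis
  proof (rule pairs_concat_induct[OF L pq, where R = "C.fellow S' (2 * K + 2)"])
    fix u u' v v' assume *: "(u, u') \<in> pairs b G1 X1 f1 L1" "(v, v') \<in> pairs b G2 X2 f2 L2"
    have X: "u \<in> lists X1" "u' \<in> lists X1" "v \<in> lists X2" "v' \<in> lists X2"
      using pairs_lists(1)[OF L *(1)] pairs_lists(2)[OF L *(2)] by blast+
    show "C.fellow S' (2 * K + 2) (u @ v) (u' @ v')"
      by (rule fellow_concat[OF X S fe1[OF *(1)] fe2[OF *(2)] N1[OF *(1)] N2[OF *(2)] add div])
  next
    fix p q assume "C.fellow S' (2 * K + 2) p q"
    then show "C.fellow S' (2 * K + 5) p q" by (rule C.fellow_mono) (use S'pos in auto)
  next
    fix u x v q assume *: "u \<in> lists X1" "x \<in> X2" "v \<in> lists X2" "q \<in> lists prodX"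
      "C.fellow S' (2 * K + 2) (u @ x # v) q"
    have "u @ x # v \<in> lists prodX" "x # u @ v \<in> lists prodX" using * by auto
    from C.fellow_perturb[OF S'pos this *(4) _ pos_move_letter[OF *(1-3)] *(5)]
    show "C.fellow S' (2 * K + 5) (x # u @ v) q" by (simp add: add.commute)
  qed
qed

lemma async_pairs_concat:
  assumes L: "L1 \<subseteq> lists X1" "L2 \<subseteq> lists X2"
    and 1: "\<forall>(u, u')\<in>pairs b G1 X1 f1 L1. async_fellow_travel G1 X1 f1 K1 u u'"
    and 2: "\<forall>(v, v')\<in>pairs b G2 X2 f2 L2. async_fellow_travel G2 X2 f2 K2 v v'"
  shows "\<exists>K. \<forall>(p, q)\<in>pairs b prodG prodX prodf (lang_concat L1 L2).
    async_fellow_travel prodG prodX prodf K p q"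
proof -
  define K where "K = max K1 K2 + 2"
  have fe1: "A.fellow {0<..} K u u'" if p: "(u, u') \<in> pairs b G1 X1 f1 L1" for u u'
  proof -
    have "u \<in> lists X1" "u' \<in> lists X1" using pairs_lists(1)[OF L p] by blast+
    then have "A.fellow {0<..} (K1 + 2) u u'" by (rule A.async_imp_fellow) (use 1 p in blast)
    then show ?thesis by (rule A.fellow_mono) (auto simp: K_def)
  qed
  have fe2: "B.fellow {0<..} K v v'" if p: "(v, v') \<in> pairs b G2 X2 f2 L2" for v v'
  proof -
    have "v \<in> lists X2" "v' \<in> lists X2" using pairs_lists(2)[OF L p] by blast+
    then have "B.fellow {0<..} (K2 + 2) v v'" by (rule B.async_imp_fellow) (use 2 p in blast)
    then show ?thesis by (rule B.fellow_mono) (auto simp: K_def)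
  qed
  have "async_fellow_travel prodG prodX prodf (2 * K + 5 + 4) p q"
    if pq: "(p, q) \<in> pairs b prodG prodX prodf (lang_concat L1 L2)" for p q
  proof (rule C.fellow_imp_async)
    show "C.fellow {0<..} (2 * K + 5) p q"
      by (rule fellow_pairs_concat[OF L slope_class_pos slope_class_pos order_refl fe1 fe2 _ _ _ _ pq,
            where N = UNIV]) auto
  qed (use pairs_lists(3)[OF L pq] in blast)+
  then show ?thesis by blast
qed

text \<open>The words that are matched with the empty word have length at most \<open>C1 + C2\<close>, so the slopes in
  \<open>fellow_concat\<close> exceed \<open>M\<close> by at most \<open>2 (C1 + C2)\<close>. Quotients of two such positive lengths lie
  between \<open>1 / (C1 + C2)\<close> and \<open>C1 + C2\<close>.\<close>

lemma bounded_async_pairs_concat: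
  assumes L: "L1 \<subseteq> lists X1" "L2 \<subseteq> lists X2" and ne: "L1 \<noteq> {}" "L2 \<noteq> {}"
    and 1: "\<forall>(u, u')\<in>pairs b G1 X1 f1 L1. bounded_async_fellow_travel G1 X1 f1 K1 M1 u u'"
    and 2: "\<forall>(v, v')\<in>pairs b G2 X2 f2 L2. bounded_async_fellow_travel G2 X2 f2 K2 M2 v v'"
  shows "\<exists>K M. \<forall>(p, q)\<in>pairs b prodG prodX prodf (lang_concat L1 L2).
    bounded_async_fellow_travel prodG prodX prodf K M p q"
proof -
  define K where "K = max K1 K2 + 2"
  define M where "M = max M1 M2"
  have e1: "1 \<le> M1 \<and> A.fellow {1/M1..M1} (K1 + 2) u u'" if p: "(u, u') \<in> pairs b G1 X1 f1 L1" for u u'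
  proof -
    have X: "u \<in> lists X1" "u' \<in> lists X1" using pairs_lists(1)[OF L p] by blast+
    have "bounded_async_fellow_travel G1 X1 f1 K1 M1 u u'" using 1 p by blast
    from A.bounded_async_imp_fellow[OF X this] show ?thesis by blast
  qed
  have e2: "1 \<le> M2 \<and> B.fellow {1/M2..M2} (K2 + 2) v v'" if p: "(v, v') \<in> pairs b G2 X2 f2 L2" for v v'
  proof -
    have X: "v \<in> lists X2" "v' \<in> lists X2" using pairs_lists(2)[OF L p] by blast+
    have "bounded_async_fellow_travel G2 X2 f2 K2 M2 v v'" using 2 p by blast
    from B.bounded_async_imp_fellow[OF X this] show ?thesis by blast
  qed
  obtain u0 v0 where "u0 \<in> L1" "v0 \<in> L2" using ne by blast
  then have "(u0, u0) \<in> combing_pairs G1 X1 f1 L1" "(v0, v0) \<in> combing_pairs G2 X2 f2 L2"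
    by (simp_all add: combing_pairs_def)
  then have M12: "1 \<le> M1" "1 \<le> M2"
    using e1[OF subsetD[OF combing_pairs_subset]] e2[OF subsetD[OF combing_pairs_subset]] by blast+
  then have M: "1 \<le> M" by (simp add: M_def)
  have pos: "{1/M..M} \<subseteq> {0<..}" if "1 \<le> M" for M :: real
    using slope_class_bounded[OF that] by (simp add: slope_class_def)
  have fe1: "A.fellow {1/M..M} K u u'" if p: "(u, u') \<in> pairs b G1 X1 f1 L1" for u u'
  proof (rule A.fellow_mono[OF conjunct2[OF e1[OF p]]])
    show "{1/M1..M1} \<subseteq> {1/M..M}" using M12 by (auto simp: M_def frac_le intro: order_trans[rotated])
  qed (use pos[OF M12(1)] in \<open>auto simp: K_def\<close>)
  have fe2: "B.fellow {1/M..M} K v v'" if p: "(v, v') \<in> pairs b G2 X2 f2 L2" for v v'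
  proof (rule B.fellow_mono[OF conjunct2[OF e2[OF p]]])
    show "{1/M2..M2} \<subseteq> {1/M..M}" using M12 by (auto simp: M_def frac_le intro: order_trans[rotated])
  qed (use pos[OF M12(2)] in \<open>auto simp: K_def\<close>)
  obtain C1 where C1: "\<forall>(u, u')\<in>bicombing_pairs G1 X1 f1 L1.
      (u = []) \<noteq> (u' = []) \<longrightarrow> length u + length u' \<le> C1"
    by (rule A.bounded_length_against_empty[OF L(1) M fe1[OF subsetD[OF combing_pairs_subset]]])
  obtain C2 where C2: "\<forall>(v, v')\<in>bicombing_pairs G2 X2 f2 L2.
      (v = []) \<noteq> (v' = []) \<longrightarrow> length v + length v' \<le> C2"
    by (rule B.bounded_length_against_empty[OF L(2) M fe2[OF subsetD[OF combing_pairs_subset]]])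
  define N where "N = {..C1 + C2}"
  define M' where "M' = M + 2 * real (C1 + C2)"
  have M': "1 \<le> M'" "M \<le> M'" "real (C1 + C2) \<le> M'" using M by (simp_all add: M'_def)
  have inv: "1 / M' \<le> 1 / M" using M M' by (simp add: frac_le)
  have "bounded_async_fellow_travel prodG prodX prodf (2 * K + 5 + 4) M' p q"
    if pq: "(p, q) \<in> pairs b prodG prodX prodf (lang_concat L1 L2)" for p q
  proof (rule C.fellow_imp_bounded_async[OF _ _ M'(1)])
    show "C.fellow {1/M'..M'} (2 * K + 5) p q"
    proof (rule fellow_pairs_concat[OF L slope_class_bounded[OF M] slope_class_bounded[OF M'(1)]
          _ fe1 fe2 _ _ _ _ pq, where N = N])
      show "{1/M..M} \<subseteq> {1/M'..M'}" using inv M' by auto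
      show "length u + length u' \<in> N" if "(u, u') \<in> pairs b G1 X1 f1 L1" "(u = []) \<noteq> (u' = [])" for u u'
        using bspec[OF C1 subsetD[OF pairs_subset that(1)]] that(2) by (simp add: N_def)
      show "length v + length v' \<in> N" if "(v, v') \<in> pairs b G2 X2 f2 L2" "(v = []) \<noteq> (v' = [])" for v v'
        using bspec[OF C2 subsetD[OF pairs_subset that(1)]] that(2) by (simp add: N_def)
      show "p + 2 * real j \<in> {1/M'..M'}" if "p \<in> {1/M..M}" "j \<in> N" for p j
      proof -
        have "real j \<le> real (C1 + C2)" using that(2) unfolding N_def by (simp only: of_nat_le_iff atMost_iff)
        then show ?thesis using that(1) inv unfolding M'_def by auto
      qed
      show "real j / real i \<in> {1/M'..M'}" if ij: "i \<in> N" "j \<in> N" "0 < i" "0 < j" for i j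
      proof -
        have le: "real i \<le> M'" "real j \<le> M'" using ij(1,2) M'(3) by (auto simp: N_def)
        have "1 / M' \<le> 1 / real i" using le(1) ij(3) by (intro frac_le) auto
        also have "\<dots> \<le> real j / real i" using ij(3,4) by (intro divide_right_mono) auto
        finally have "1 / M' \<le> real j / real i" .
        moreover have "real j / real i \<le> real j / 1" using ij(3) by (intro divide_left_mono) auto
        ultimately show ?thesis using le(2) by simp
      qed
    qed
  qed (use pairs_lists(3)[OF L pq] in blast)+
  then show ?thesis by blast
qed

text \<open>At time \<open>t\<close> the second coordinates are \<open>v(t - l(u))\<close> and \<open>v'(t - l(u'))\<close>, and \<open>v(t - l(u'))\<close> is close
  to both: to the first because \<open>L1\<close> is near geodesic, to the second because \<open>v\<close> and \<open>v'\<close> fellow travel.\<close>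

lemma sync_pairs_concat:
  assumes L: "L1 \<subseteq> lists X1" "L2 \<subseteq> lists X2" and ng: "near_geodesic G1 X1 f1 L1"
    and 1: "\<forall>(u, u')\<in>pairs b G1 X1 f1 L1. sync_fellow_travel G1 X1 f1 K1 u u'"
    and 2: "\<forall>(v, v')\<in>pairs b G2 X2 f2 L2. sync_fellow_travel G2 X2 f2 K2 v v'"
  shows "\<exists>K. \<forall>(p, q)\<in>pairs b prodG prodX prodf (lang_concat L1 L2).
    sync_fellow_travel prodG prodX prodf K p q"
proof -
  obtain C where C: "\<And>u u'. (u, u') \<in> bicombing_pairs G1 X1 f1 L1
      \<Longrightarrow> \<bar>real (length u) - real (length u')\<bar> \<le> C"
    by (rule A.near_geodesic_length_diff[OF ng]) blast
  define K where "K = K1 + 2 + (C + 1 + (K2 + 2))"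
  let ?near = "\<lambda>K p q. \<forall>t. C.cdist (C.pos p t) (C.pos q t) \<le> K"
  have near: "?near (K + 3) p q"
    if pq: "(p, q) \<in> pairs b prodG prodX prodf (lang_concat L1 L2)" for p q
  proof (rule pairs_concat_induct[OF L pq, where R = "?near K"])
    fix u u' v v' assume *: "(u, u') \<in> pairs b G1 X1 f1 L1" "(v, v') \<in> pairs b G2 X2 f2 L2"
    have X: "u \<in> lists X1" "u' \<in> lists X1" "v \<in> lists X2" "v' \<in> lists X2"
      using pairs_lists(1)[OF L *(1)] pairs_lists(2)[OF L *(2)] by blast+
    have sy: "sync_fellow_travel G1 X1 f1 K1 u u'" "sync_fellow_travel G2 X2 f2 K2 v v'"
      using 1 2 * by blast+
    show "?near K (u @ v) (u' @ v')"
    proof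
      fix t :: real
      let ?s = "t - length u" and ?s' = "t - length u'"
      have "\<bar>?s - ?s'\<bar> \<le> C" using C[OF subsetD[OF pairs_subset *(1)]] by linarith
      then have "B.cdist (B.pos v ?s) (B.pos v ?s') \<le> C + 1"
        using B.pos_lipschitz[OF X(3), of ?s ?s'] by linarith
      moreover have "B.cdist (B.pos v ?s') (B.pos v' ?s') \<le> K2 + 2"
        by (rule B.sync_imp_near[OF X(3,4) sy(2)])
      moreover have "B.cdist (B.pos v ?s) (B.pos v' ?s')
          \<le> B.cdist (B.pos v ?s) (B.pos v ?s') + B.cdist (B.pos v ?s') (B.pos v' ?s')"
        using X by (intro B.cdist_triangle) auto
      moreover have "A.cdist (A.pos u t) (A.pos u' t) \<le> K1 + 2"
        by (rule A.sync_imp_near[OF X(1,2) sy(1)])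
      ultimately show "C.cdist (C.pos (u @ v) t) (C.pos (u' @ v') t) \<le> K"
        using cdist_concat_le[OF X, of t t] unfolding K_def by linarith
    qed
  next
    fix p q assume R: "?near K p q"
    show "?near (K + 3) p q"
    proof
      fix t show "C.cdist (C.pos p t) (C.pos q t) \<le> K + 3" using spec[OF R, of t] by linarith
    qed
  next
    fix u x v q assume *: "u \<in> lists X1" "x \<in> X2" "v \<in> lists X2" "q \<in> lists prodX"
      and R: "?near K (u @ x # v) q"
    have X: "u @ x # v \<in> lists prodX" "x # u @ v \<in> lists prodX" using * by auto
    show "?near (K + 3) (x # u @ v) q"
    proof
      fix t :: real
      have "C.cdist (C.pos (x # u @ v) t) (C.pos q t)
          \<le> C.cdist (C.pos (x # u @ v) t) (C.pos (u @ x # v) t) + C.cdist (C.pos (u @ x # v) t) (C.pos q t)"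
        by (intro C.cdist_triangle C.pos_closed X *(4))
      then show "C.cdist (C.pos (x # u @ v) t) (C.pos q t) \<le> K + 3"
        using pos_move_letter[OF *(1-3), of t] spec[OF R, of t] by linarith
    qed
  qed
  have "sync_fellow_travel prodG prodX prodf (K + 3 + 2) p q"
    if pq: "(p, q) \<in> pairs b prodG prodX prodf (lang_concat L1 L2)" for p q
    by (rule C.near_imp_sync) (use pairs_lists(3)[OF L pq] near[OF pq] in blast)+
  then show ?thesis by blast
qed

lemma async_combing_concat:
  "async_combing G1 X1 f1 L1 \<Longrightarrow> async_combing G2 X2 f2 L2
    \<Longrightarrow> async_combing prodG prodX prodf (lang_concat L1 L2)"
  "async_bicombing G1 X1 f1 L1 \<Longrightarrow> async_bicombing G2 X2 f2 L2
    \<Longrightarrow> async_bicombing prodG prodX prodf (lang_concat L1 L2)"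
  using async_pairs_concat[where b = False] async_pairs_concat[where b = True] language_for_concat
  unfolding async_combing_def async_bicombing_def pairs_def language_for_def[of G1] language_for_def[of G2]
  by auto

lemma bounded_async_combing_concat:
  "bounded_async_combing G1 X1 f1 L1 \<Longrightarrow> bounded_async_combing G2 X2 f2 L2
    \<Longrightarrow> bounded_async_combing prodG prodX prodf (lang_concat L1 L2)"
  "bounded_async_bicombing G1 X1 f1 L1 \<Longrightarrow> bounded_async_bicombing G2 X2 f2 L2
    \<Longrightarrow> bounded_async_bicombing prodG prodX prodf (lang_concat L1 L2)"
proof -
  have ne: "L1 \<noteq> {}" "L2 \<noteq> {}" if "language_for G1 X1 f1 L1" "language_for G2 X2 f2 L2"
    using that A.one_closed B.one_closed unfolding language_for_def by blast+
  show "bounded_async_combing prodG prodX prodf (lang_concat L1 L2)"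
    if "bounded_async_combing G1 X1 f1 L1" "bounded_async_combing G2 X2 f2 L2"
  proof -
    have lf: "language_for G1 X1 f1 L1" "language_for G2 X2 f2 L2"
      using that by (simp_all add: bounded_async_combing_def)
    then have L: "L1 \<subseteq> lists X1" "L2 \<subseteq> lists X2" by (simp_all add: language_for_def)
    show ?thesis
      using that bounded_async_pairs_concat[OF L ne[OF lf], where b = False] language_for_concat[OF lf]
      unfolding bounded_async_combing_def pairs_def by auto
  qed
  show "bounded_async_bicombing prodG prodX prodf (lang_concat L1 L2)"
    if "bounded_async_bicombing G1 X1 f1 L1" "bounded_async_bicombing G2 X2 f2 L2"
  proof -
    have lf: "language_for G1 X1 f1 L1" "language_for G2 X2 f2 L2"
      using that by (simp_all add: bounded_async_bicombing_def)
    then have L: "L1 \<subseteq> lists X1" "L2 \<subseteq> lists X2" by (simp_all add: language_for_def)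
    show ?thesis
      using that bounded_async_pairs_concat[OF L ne[OF lf], where b = True] language_for_concat[OF lf]
      unfolding bounded_async_bicombing_def pairs_def by auto
  qed
qed

lemma sync_combing_concat:
  assumes "near_geodesic G1 X1 f1 L1"
  shows "sync_combing G1 X1 f1 L1 \<Longrightarrow> sync_combing G2 X2 f2 L2
    \<Longrightarrow> sync_combing prodG prodX prodf (lang_concat L1 L2)"
  and "sync_bicombing G1 X1 f1 L1 \<Longrightarrow> sync_bicombing G2 X2 f2 L2
    \<Longrightarrow> sync_bicombing prodG prodX prodf (lang_concat L1 L2)"
  using sync_pairs_concat[OF _ _ assms, where b = False] sync_pairs_concat[OF _ _ assms, where b = True]
    language_for_concat
  unfolding sync_combing_def sync_bicombing_def pairs_def language_for_def[of G1] language_for_def[of G2]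
  by auto

end

theorem proposition6p2:
  fixes G1 :: "('a, 'm) monoid_scheme" and G2 :: "('b, 'n) monoid_scheme"
    and X1 X2 :: "'c set" and f1 :: "'c \<Rightarrow> 'a" and f2 :: "'c \<Rightarrow> 'b"
    and L1 L2 :: "'c list set" and F :: "'c list set set"
  defines "G \<equiv> G1 \<times>\<times> G2" and "X \<equiv> X1 \<union> X2" and "f \<equiv> product_gens G1 G2 X1 f1 f2"
    and "L \<equiv> lang_concat L1 L2"
  assumes "group G1" and "group G2"
    and "generating_set G1 X1 f1" and "generating_set G2 X2 f2"
    and "\<forall>x\<in>X1 \<inter> X2. f1 x = \<one>\<^bsub>G1\<^esub> \<and> f2 x = \<one>\<^bsub>G2\<^esub>"
    and "language_family F" and "\<forall>A\<in>F. \<forall>B\<in>F. lang_concat A B \<in> F"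
    and "L1 \<in> F" and "combing G1 X1 f1 L1"
    and "L2 \<in> F" and "combing G2 X2 f2 L2"
  shows "generating_set G X f
    \<and> L \<in> F \<and> async_combing G X f L
    \<and> (async_bicombing G1 X1 f1 L1 \<and> async_bicombing G2 X2 f2 L2 \<longrightarrow> async_bicombing G X f L)
    \<and> (bijective_language G1 X1 f1 L1 \<and> bijective_language G2 X2 f2 L2
         \<longrightarrow> bijective_language G X f L)
    \<and> (near_geodesic G1 X1 f1 L1 \<longrightarrow>
         (sync_combing G1 X1 f1 L1 \<and> sync_combing G2 X2 f2 L2 \<longrightarrow> sync_combing G X f L)
       \<and> (sync_bicombing G1 X1 f1 L1 \<and> sync_bicombing G2 X2 f2 L2 \<longrightarrow> sync_bicombing G X f L)
       \<and> (bounded_async_combing G1 X1 f1 L1 \<and> bounded_async_combing G2 X2 f2 L2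
            \<longrightarrow> bounded_async_combing G X f L)
       \<and> (bounded_async_bicombing G1 X1 f1 L1 \<and> bounded_async_bicombing G2 X2 f2 L2
            \<longrightarrow> bounded_async_bicombing G X f L))"
proof -
  interpret marked_product G1 X1 f1 G2 X2 f2
    by (intro marked_product.intro marked_group.intro marked_group_axioms.intro
        marked_product_axioms.intro assms(5-9))
  have "L \<in> F" using assms(11,12,14) unfolding L_def by blast
  moreover have "async_combing G X f L"
    unfolding G_def X_def f_def L_def
    by (intro async_combing_concat(1) A.combing_imp_async_combing B.combing_imp_async_combing assms(13,15))
  ultimately show ?thesis
    using C.gens async_combing_concat(2) bijective_language_concat sync_combing_concat
      bounded_async_combing_concat
    unfolding G_def X_def f_def L_def by blast
qed

end
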